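(* For every integer $r\ge1$, the function $\tfrac12\psi_0((\beta^*\beta)^r)$ of the variable $q\in\,]0,1[$ is of the form $$\tfrac12\psi_0((\beta^*\beta)^r)=q^{-2r}\big(q^2R_r(q^2)-G(q^2)\big),$$ where $R_r(q^2)$ is a rational fraction of $q^2$ with poles only at roots of unity.
   Context: For $q\in\,]0,1[$: $\mathcal H$ is the Hilbert space with orthonormal basis $e^{(n)}_{ij}$, $n\in\frac12\mathbb N$, $i,j\in\{-n,\dots,n\}$, and $\beta e^{(n)}_{ij}=b_+(n,i,j)\,e^{(n+1/2)}_{i+1/2,j-1/2}+b_-(n,i,j)\,e^{(n-1/2)}_{i+1/2,j-1/2}$, with $$b_+=-q^{n+j}\frac{(1-q^{2n-2j+2})^{1/2}(1-q^{2n+2i+2})^{1/2}}{(1-q^{4n+2})^{1/2}(1-q^{4n+4})^{1/2}},\quad b_-=q^{n+i}\frac{(1-q^{2n+2j})^{1/2}(1-q^{2n-2i})^{1/2}}{(1-q^{4n})^{1/2}(1-q^{4n+2})^{1/2}}$$ (terms with vanishing coefficient are $0$; $b_-=0$ for $n=0$). $D e^{(n)}_{ij}=(2\delta_0(n-i)-1)2n\,e^{(n)}_{ij}$ ($\delta_0(0)=1$, $\delta_0(k)=0$ for $k\ne0$), so $|D|e^{(n)}_{ij}=2n\,e^{(n)}_{ij}$, where $|D|$ is replaced by an arbitrary positive constant on the one-dimensional kernel; $P$ is the orthogonal projection on the span of the $e^{(n)}_{ij}$ with $i=n$. $\psi_0(a)=2\,\mathrm{Trace}(a\,P\,|D|^{-s})_{s=0}$,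 the value at $s=0$ of the analytic continuation in $s$. $G(q^2)=\sum_{n=1}^\infty n\,q^{2n}(1-q^{2n})^{-1}$, which is, up to sign and after subtraction of the constant term, the logarithmic derivative $q^2\partial_{q^2}\log\eta$ of the Dedekind eta function $\eta(q^2)=q^{1/12}\prod_{n\ge1}(1-q^{2n})$. *)

theory Defs
  imports "HOL-Complex_Analysis.Complex_Analysis"
begin

text \<open>
  The Hilbert space is \<open>\<ell>\<^sup>2\<close> over the index set \<open>idx\<close> of the triples \<open>(n, i, j)\<close>, realised as the
  square-summable functions vanishing outside \<open>idx\<close>.  The inner product is linear in the second
  argument, and \<open>ket x\<close> is the orthonormal basis vector with index \<open>x\<close>.
\<close>

type_synonym index = "real \<times> real \<times> real"
type_synonym vec = "index \<Rightarrow> complex"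

definition idx :: "index set" where
  "idx = {(n, i, j). 2 * n \<in> \<nat> \<and> n + i \<in> \<nat> \<and> n - i \<in> \<nat> \<and> n + j \<in> \<nat> \<and> n - j \<in> \<nat>}"

definition ell2 :: "vec set" where
  "ell2 = {f. (\<forall>x. x \<notin> idx \<longrightarrow> f x = 0) \<and> (\<lambda>x. (cmod (f x))\<^sup>2) summable_on idx}"

definition inner_prod :: "vec \<Rightarrow> vec \<Rightarrow> complex" where
  "inner_prod f g = (\<Sum>\<^sub>\<infinity>x\<in>idx. cnj (f x) * g x)"

definition ket :: "index \<Rightarrow> vec" where
  "ket x = (\<lambda>y. if y = x then 1 else 0)"

text \<open>
  The operator given on the basis by \<open>ket x \<mapsto> v x\<close>, extended to all vectors coordinatewise.
  For \<open>v x\<close> the images of the basis vectors under a bounded operator this is that operator,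
  since its coordinate functionals are continuous.
\<close>

definition extend_op :: "(index \<Rightarrow> vec) \<Rightarrow> vec \<Rightarrow> vec" where
  "extend_op v f = (\<lambda>y. \<Sum>\<^sub>\<infinity>x\<in>idx. f x * v x y)"

lemma extend_op_ket:
  assumes "x \<in> idx"
  shows "extend_op v (ket x) = v x"
proof
  fix y
  have "(\<Sum>\<^sub>\<infinity>z\<in>idx. ket x z * v z y) = (\<Sum>\<^sub>\<infinity>z\<in>{x}. ket x z * v z y)"
    by (rule infsum_cong_neutral) (use assms in \<open>auto simp: ket_def\<close>)
  then show "extend_op v (ket x) y = v x y"
    by (simp add: extend_op_def ket_def)
qed

text \<open>The values of the adjoint outside \<open>ell2\<close> are irrelevant and left unspecified.\<close>

definition adj :: "(vec \<Rightarrow> vec) \<Rightarrow> vec \<Rightarrow> vec" where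
  "adj T = (SOME S. \<forall>f\<in>ell2. S f \<in> ell2 \<and> (\<forall>g\<in>ell2. inner_prod (S f) g = inner_prod f (T g)))"

definition b_plus :: "real \<Rightarrow> real \<Rightarrow> real \<Rightarrow> real \<Rightarrow> real" where
  "b_plus q n i j =
     - (q powr (n + j)) *
       (sqrt (1 - q powr (2 * n - 2 * j + 2)) * sqrt (1 - q powr (2 * n + 2 * i + 2))) /
       (sqrt (1 - q powr (4 * n + 2)) * sqrt (1 - q powr (4 * n + 4)))"

definition b_minus :: "real \<Rightarrow> real \<Rightarrow> real \<Rightarrow> real \<Rightarrow> real" where
  "b_minus q n i j =
     (if n = 0 then 0 else
       q powr (n + i) *
       (sqrt (1 - q powr (2 * n + 2 * j)) * sqrt (1 - q powr (2 * n - 2 * i))) /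
       (sqrt (1 - q powr (4 * n)) * sqrt (1 - q powr (4 * n + 2))))"

text \<open>
  If \<open>(n - 1/2, i + 1/2, j - 1/2)\<close> is not an index, i.e. \<open>i = n\<close> or \<open>j = - n\<close>, then
  \<open>b_minus q n i j = 0\<close>, so no basis vector outside \<open>idx\<close> contributes.
\<close>

definition beta :: "real \<Rightarrow> vec \<Rightarrow> vec" where
  "beta q = extend_op (\<lambda>(n, i, j) y.
     of_real (b_plus q n i j) * ket (n + 1/2, i + 1/2, j - 1/2) y +
     of_real (b_minus q n i j) * ket (n - 1/2, i + 1/2, j - 1/2) y)"

definition P :: "vec \<Rightarrow> vec" where
  "P = extend_op (\<lambda>(n, i, j) y. if i = n then ket (n, i, j) y else 0)"

text \<open>
  \<open>D\<close> is diagonal with eigenvalues \<open>D_eig\<close>; \<open>absD_eig c\<close> lists the eigenvalues of its absolute value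
  with the value on the kernel replaced by the constant \<open>c\<close>.
\<close>

definition D_eig :: "index \<Rightarrow> real" where
  "D_eig = (\<lambda>(n, i, j). (2 * (if n - i = 0 then 1 else 0) - 1) * (2 * n))"

definition absD_eig :: "real \<Rightarrow> index \<Rightarrow> real" where
  "absD_eig c x = (if D_eig x = 0 then c else \<bar>D_eig x\<bar>)"

definition absD_power :: "real \<Rightarrow> complex \<Rightarrow> vec \<Rightarrow> vec" where
  "absD_power c z = extend_op (\<lambda>x y. of_real (absD_eig c x) powr z * ket x y)"

definition has_trace :: "(vec \<Rightarrow> vec) \<Rightarrow> complex \<Rightarrow> bool" where
  "has_trace T t \<longleftrightarrow> ((\<lambda>x. inner_prod (ket x) (T (ket x))) has_sum t) idx"

text \<open>
  \<open>v\<close> is the value at \<open>0\<close> of the continuation of \<open>s \<mapsto> Trace (T s)\<close> from a right half-plane on which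
  the trace converges to a half-plane containing \<open>0\<close>.  Poles are allowed on the way but not at \<open>0\<close>.
  By the identity theorem there is at most one such \<open>v\<close>; the condition \<open>g analytic_on {0}\<close> excludes
  an arbitrary value of \<open>g\<close> at \<open>0\<close>, which \<open>meromorphic_on\<close> by itself permits.
\<close>

definition trace_value_at_0 :: "(complex \<Rightarrow> vec \<Rightarrow> vec) \<Rightarrow> complex \<Rightarrow> bool" where
  "trace_value_at_0 T v \<longleftrightarrow>
     (\<exists>g \<tau> \<sigma>. \<tau> < 0 \<and> g meromorphic_on {s. Re s > \<tau>} \<and> g analytic_on {0} \<and> g 0 = v \<and>
        (\<forall>s. Re s > \<sigma> \<longrightarrow> has_trace (T s) (g s)))"

definition psi0 :: "real \<Rightarrow> (vec \<Rightarrow> vec) \<Rightarrow> complex" where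
  "psi0 c a = 2 * (THE v. trace_value_at_0 (\<lambda>s. a \<circ> P \<circ> absD_power c (- s)) v)"

text \<open>As a function of \<open>x = q\<^sup>2\<close>.\<close>

definition G :: "real \<Rightarrow> real" where
  "G x = (\<Sum>n. real (Suc n) * x ^ Suc n * inverse (1 - x ^ Suc n))"

end

theory Submission
  imports Defs
begin

text \<open>
  The operator \<open>\<beta>\<close> is normal and maps the range of \<open>P\<close> to itself, acting there as a weighted shift,
  so the diagonal entries of \<open>(\<beta>\<^sup>*\<beta>)\<^sup>r\<close> on that range are squared norms of \<open>\<beta>\<^sup>r e\<close>, i.e. products of squared
  weights. Put \<open>x = q\<^sup>2\<close> and let \<open>S\<^sub>r(N)\<close> be the sum of the entries with \<open>2n = N\<close>. It converges to
  \<open>C\<^sub>r = 1 / (1 - x\<^sup>r)\<close> exponentially fast, so \<open>\<zeta>(0) = -1/2\<close> gives \<open>\<psi>\<^sub>0 / 2 = Z\<^sub>r + C\<^sub>r / 2\<close> with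
  \<open>Z\<^sub>r = \<Sum>\<^sub>N (S\<^sub>r(N) - C\<^sub>r)\<close>. The deviations \<open>d\<^sub>r(N) = S\<^sub>r(N) - C\<^sub>r\<close> satisfy
  \<open>(1 - x\<^sup>r) x d\<^bsub>r+1\<^esub>(N) = d\<^sub>r(N + 1) - x\<^sup>r d\<^sub>r(N)\<close>; summing over \<open>N\<close> shows that \<open>x\<^sup>r Z\<^sub>r\<close> changes only by a
  rational function when \<open>r\<close> is increased, while \<open>x Z\<^sub>1 = x / (1 - x) - G(x)\<close>.
\<close>

subsection \<open>Finite q-sums\<close>

text \<open>The adjoint of \<beta> does not preserve the range of \<open>P\<close>, so powers of
  \<open>adj (beta q) \<circ> beta q\<close> cannot be computed inside it. Normality circumvents
  this: pulling one \<beta> through the power turns the entry of power r + 1 at e into that of power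
  r at \<beta> e, one level higher. The limit C_r is geometric: for fixed k the q-products tend to
  1, which leaves the sum of the x^(r k). With zeta(0) = -1/2 the constant part alone would give
  -C_r / 2. The kernel of \<open>D\<close> adds the level N = 0, where c^(-s) is 1 at s = 0 for
  every c, and this changes the sign to +C_r / 2. The recursion for d_r comes from two relations for
  S_r: \<open>level_sum_Suc\<close> raises N at fixed r, \<open>level_trace_Suc_index\<close> raises
  r at fixed N. Eliminating S_r leaves a right-hand side that sums to a multiple of Z_r plus a
  boundary term. G enters at r = 0: all entries are 1 there, so S_0(N) = N + 1, and raising r once
  gives the terms of a Lambert series from exponent 2 onwards; the absent first term is x / (1 -
  x).\<close>

definition qprod :: "real \<Rightarrow> nat \<Rightarrow> nat \<Rightarrow> real" where
  "qprod x r a = (\<Prod>l<r. 1 - x ^ (a + l))"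

lemma qprod_Suc: "qprod x (Suc r) a = qprod x r a * (1 - x ^ (a + r))"
  by (simp add: qprod_def)

text \<open>\<open>qprod x r a\<close> is the q-Pochhammer symbol \<open>(x^a; x)_r\<close>. Most
  identities below compare splitting off its last factor (\<open>qprod_Suc\<close>) with splitting
  off its first.\<close>

lemma qprod_Suc': "qprod x (Suc r) a = (1 - x ^ a) * qprod x r (Suc a)"
  unfolding qprod_def by (subst prod.lessThan_Suc_shift) simp

lemma qprod_pos:
  assumes "0 < x" "x < 1" "0 < a"
  shows "0 < qprod x r a"
  unfolding qprod_def
  by (intro prod_pos ballI) (use assms in \<open>auto intro: power_Suc_less_one simp: power_less_one_iff\<close>)

lemma qprod_mono:
  assumes "0 < x" "x < 1" "0 < a" "a \<le> b"
  shows "qprod x r a \<le> qprod x r b"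
  unfolding qprod_def
  by (intro prod_mono) (use assms in \<open>auto intro!: power_decreasing simp: power_le_one\<close>)

text \<open>
  \<open>level_entry x r N k\<close> is the diagonal entry of \<open>(\<beta>\<^sup>*\<beta>)\<^sup>r\<close> at \<open>(n, n, j)\<close> for \<open>x = q\<^sup>2\<close>, \<open>N = 2n\<close>, \<open>k = n + j\<close>;
  see \<open>modulus_sq_pow_entry\<close>.
\<close>

definition level_entry :: "real \<Rightarrow> nat \<Rightarrow> nat \<Rightarrow> nat \<Rightarrow> real" where
  "level_entry x r N k = x ^ (r * k) * qprod x r (N - k + 1) / qprod x r (N + 2)"

definition level_trace :: "real \<Rightarrow> nat \<Rightarrow> nat \<Rightarrow> real" where
  "level_trace x r N = (\<Sum>k\<le>N. level_entry x r N k)"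

definition level_sum :: "real \<Rightarrow> nat \<Rightarrow> nat \<Rightarrow> real" where
  "level_sum x r N = (\<Sum>k\<le>N. x ^ (r * k) * qprod x r (N - k + 1))"

lemma level_trace_eq: "level_trace x r N = level_sum x r N / qprod x r (N + 2)"
  by (simp add: level_trace_def level_sum_def level_entry_def sum_divide_distrib)

lemma level_sum_0: "level_sum x r 0 = qprod x r 1"
  by (simp add: level_sum_def)

text \<open>Passing from k to k + 1 along with N keeps N - k and costs a factor x^r; the new term is
  k = 0.\<close>

lemma level_sum_Suc: "level_sum x r (Suc N) = qprod x r (N + 2) + x ^ r * level_sum x r N"
  unfolding level_sum_def
  by (subst sum.atMost_Suc_shift) (simp add: sum_distrib_left power_add mult_ac)

text \<open>Multiplied by \<open>d\<close>, both sides satisfy the recursion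
  \<open>F(N+1) = d * qprod x r (N+3) + x^(r+1) * F(N)\<close>, so only the initial values have to
  be compared.\<close>

lemma level_sum_Suc_index:
  assumes "0 < x" "x < 1"
  shows "level_sum x (Suc r) N + x ^ Suc N * level_sum x r (Suc N) =
         qprod x (Suc r) (N + 2) / (1 - x ^ Suc r)"
proof -
  define d where "d = 1 - x ^ Suc r"
  have d: "d \<noteq> 0"
    unfolding d_def using power_Suc_less_one[OF assms] by (metis less_irrefl right_minus_eq)
  have "d * (level_sum x (Suc r) N + x ^ Suc N * level_sum x r (Suc N)) = qprod x (Suc r) (N + 2)"
  proof (induction N)
    case 0
    have 1: "qprod x (Suc r) 1 = (1 - x) * qprod x r 2"
      by (simp add: qprod_Suc' numeral_2_eq_2)
    have 2: "(1 - x ^ Suc r) * qprod x r 1 = qprod x (Suc r) 1"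
      by (simp add: qprod_Suc)
    have 3: "qprod x (Suc r) 2 = qprod x r 2 * (1 - x * x ^ Suc r)"
      by (simp add: qprod_Suc)
    have "(1 - x ^ Suc r) * (qprod x (Suc r) 1 + x * (qprod x r 2 + x ^ r * qprod x r 1))
        = (1 - x ^ Suc r) * qprod x (Suc r) 1 + x * (1 - x ^ Suc r) * qprod x r 2
          + x ^ Suc r * ((1 - x ^ Suc r) * qprod x r 1)"
      by (simp add: algebra_simps)
    also have "\<dots> = qprod x (Suc r) 1 + x * (1 - x ^ Suc r) * qprod x r 2"
      unfolding 2 by (simp add: algebra_simps)
    also have "\<dots> = qprod x (Suc r) 2"
      unfolding 1 3 by (simp add: algebra_simps)
    finally have "(1 - x ^ Suc r) * (qprod x (Suc r) 1 + x * (qprod x r 2 + x ^ r * qprod x r 1))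
        = qprod x (Suc r) 2" .
    then show ?case
      by (simp add: d_def level_sum_Suc level_sum_0 numeral_2_eq_2)
  next
    case (Suc N)
    have 1: "qprod x (Suc r) (N + 2) = (1 - x ^ (N + 2)) * qprod x r (N + 3)"
      by (simp add: qprod_Suc' numeral_eq_Suc)
    have 2: "qprod x (Suc r) (Suc N + 2) = qprod x r (N + 3) * (1 - x ^ (N + 3) * x ^ r)"
      by (simp add: qprod_Suc numeral_eq_Suc power_add)
    have 3: "level_sum x r (Suc (Suc N)) = qprod x r (N + 3) + x ^ r * level_sum x r (Suc N)"
      by (subst level_sum_Suc) (simp add: numeral_eq_Suc)
    have 4: "level_sum x (Suc r) (Suc N) = qprod x (Suc r) (N + 2) + x ^ Suc r * level_sum x (Suc r) N"
      by (rule level_sum_Suc)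
    have "level_sum x (Suc r) (Suc N) + x ^ Suc (Suc N) * level_sum x r (Suc (Suc N)) =
        qprod x (Suc r) (N + 2) + x ^ (N + 2) * qprod x r (N + 3)
        + x ^ Suc r * (level_sum x (Suc r) N + x ^ Suc N * level_sum x r (Suc N))"
      unfolding 3 4 by (simp add: algebra_simps)
    \<comment> \<open>The factor \<open>1 - x ^ (N + 2)\<close> from fact 1 is completed to 1 by the
      neighbouring term.\<close>
    also have "\<dots> = qprod x r (N + 3)
        + x ^ Suc r * (level_sum x (Suc r) N + x ^ Suc N * level_sum x r (Suc N))"
      unfolding 1 by (simp add: algebra_simps)
    finally have *: "level_sum x (Suc r) (Suc N) + x ^ Suc (Suc N) * level_sum x r (Suc (Suc N)) =
        qprod x r (N + 3) + x ^ Suc r * (level_sum x (Suc r) N + x ^ Suc N * level_sum x r (Suc N))" .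
    have "d * (level_sum x (Suc r) (Suc N) + x ^ Suc (Suc N) * level_sum x r (Suc (Suc N))) =
        d * qprod x r (N + 3) + x ^ Suc r * qprod x (Suc r) (N + 2)"
      unfolding * Suc.IH[symmetric] by (simp add: algebra_simps)
    also have "\<dots> = qprod x (Suc r) (Suc N + 2)"
      unfolding d_def 1 2 by (simp add: algebra_simps numeral_eq_Suc)
    finally show ?case .
  qed
  then show ?thesis
    using d unfolding d_def[symmetric] by (simp add: field_simps)
qed

text \<open>Dividing by \<open>qprod x (Suc r) (N + 2)\<close> separates the limit from an exact
  error, whose factor \<open>x ^ Suc N\<close> is the exponential decay.\<close>

lemma level_trace_Suc_index:
  assumes "0 < x" "x < 1"
  shows "level_trace x (Suc r) N =
    1 / (1 - x ^ Suc r) - x ^ Suc N * (1 + x ^ r * level_trace x r N) / (1 - x ^ (N + r + 2))"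
proof -
  define p where "p = qprod x r (N + 2)"
  define u where "u = 1 - x ^ (N + r + 2)"
  define d where "d = 1 - x ^ Suc r"
  have p: "p \<noteq> 0"
    unfolding p_def using qprod_pos[OF assms, of "N+2" r] by simp
  have u: "u \<noteq> 0" 
    unfolding u_def using power_Suc_less_one[OF assms, of "N + r + 1"]
    by (metis Suc_eq_plus1 add_2_eq_Suc' less_irrefl right_minus_eq)
  have d: "d \<noteq> 0"
    unfolding d_def using power_Suc_less_one[OF assms] by (metis less_irrefl right_minus_eq)
  have 1: "qprod x (Suc r) (N + 2) = p * u"
    by (simp add: qprod_Suc p_def u_def add_ac)
  have 2: "level_sum x (Suc r) N + x ^ Suc N * (p + x ^ r * level_sum x r N) = p * u / d"
    using level_sum_Suc_index[OF assms, of r N] unfolding 1 level_sum_Suc p_def d_def by simp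
  then have 2: "level_sum x (Suc r) N = p * u / d - x ^ Suc N * (p + x ^ r * level_sum x r N)"
    by (simp only: eq_diff_eq)
  show ?thesis
    unfolding level_trace_eq 1 2 u_def[symmetric] d_def[symmetric] p_def[symmetric]
    using p u d by (simp add: field_simps)
qed

lemma level_entry_bounds:
  assumes "0 < x" "x < 1" "k \<le> N"
  shows "0 \<le> level_entry x r N k" "level_entry x r N k \<le> 1"
proof -
  have p: "0 < qprod x r (N + 2)" "0 < qprod x r (N - k + 1)"
    using qprod_pos assms by auto
  then show "0 \<le> level_entry x r N k"
    unfolding level_entry_def using assms by (intro divide_nonneg_pos mult_nonneg_nonneg) auto
  have "x ^ (r * k) * qprod x r (N - k + 1) \<le> 1 * qprod x r (N + 2)"
    using assms p by (intro mult_mono qprod_mono) (auto simp: power_le_one)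
  then show "level_entry x r N k \<le> 1"
    unfolding level_entry_def using p by (simp add: divide_simps)
qed

lemma level_trace_bounds:
  assumes "0 < x" "x < 1"
  shows "0 \<le> level_trace x r N" "level_trace x r N \<le> N + 1"
proof -
  show "0 \<le> level_trace x r N"
    unfolding level_trace_def using level_entry_bounds assms by (intro sum_nonneg) auto
  have "level_trace x r N \<le> (\<Sum>k\<le>N. 1)"
    unfolding level_trace_def using level_entry_bounds assms by (intro sum_mono) auto
  then show "level_trace x r N \<le> N + 1"
    by simp
qed

text \<open>The lemmas below concern r >= 1; at r = 0 the quotient is 1 / 0 = 0 and nothing is
  subtracted.\<close>

definition level_dev :: "real \<Rightarrow> nat \<Rightarrow> nat \<Rightarrow> real" where
  "level_dev x r N = level_trace x r N - 1 / (1 - x ^ r)"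

lemma level_dev_eq:
  assumes "0 < x" "x < 1"
  shows "level_dev x (Suc r) N =
    - (x ^ Suc N * (1 + x ^ r * level_trace x r N) / (1 - x ^ (N + r + 2)))"
  unfolding level_dev_def level_trace_Suc_index[OF assms] by simp

lemma level_dev_1:
  assumes "0 < x" "x < 1"
  shows "x * level_dev x 1 N = - (real (N + 2) * x ^ (N + 2) * inverse (1 - x ^ (N + 2)))"
proof -
  have "level_trace x 0 N = N + 1"
    by (simp add: level_trace_def level_entry_def qprod_def)
  then show ?thesis
    unfolding One_nat_def level_dev_eq[OF assms] by (simp add: field_simps)
qed

lemma abs_level_dev_le:
  assumes "0 < x" "x < 1"
  shows "\<bar>level_dev x (Suc r) N\<bar> \<le> real (N + 2) * x ^ N / (1 - x)"
proof -
  have 1: "1 - x \<le> 1 - x ^ (N + r + 2)"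
    using assms power_decreasing[of 1 "N + r + 2" x] by simp
  have 2: "x ^ r * level_trace x r N \<le> 1 * real (N + 1)"
    using level_trace_bounds[OF assms, of r N] assms by (intro mult_mono) (auto simp: power_le_one)
  have 3: "0 \<le> x ^ r * level_trace x r N"
    using level_trace_bounds[OF assms, of r N] assms by simp
  have "\<bar>level_dev x (Suc r) N\<bar> = x ^ Suc N * (1 + x ^ r * level_trace x r N) / (1 - x ^ (N + r + 2))"
    unfolding level_dev_eq[OF assms] abs_minus_cancel
    by (intro abs_of_nonneg divide_nonneg_nonneg mult_nonneg_nonneg) (use 3 assms in \<open>auto intro: power_le_one simp del: power_Suc\<close>)
  also have "\<dots> \<le> x ^ N * real (N + 2) / (1 - x)"
  proof (rule frac_le)
    have "x ^ Suc N \<le> x ^ N" using assms by (intro power_decreasing) auto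
    then show "x ^ Suc N * (1 + x ^ r * level_trace x r N) \<le> x ^ N * real (N + 2)"
      using 2 3 assms by (intro mult_mono) auto
  qed (use 1 assms in auto)
  finally show ?thesis by (simp add: mult.commute)
qed

text \<open>The weight \<open>Suc N\<close> is what \<open>dirichlet_continuation\<close> asks for:
  it absorbs the growth of N^(-s) for negative Re s.\<close>

lemma summable_level_dev:
  assumes "0 < x" "x < 1"
  shows "summable (\<lambda>N. real (Suc N) * \<bar>level_dev x (Suc r) N\<bar>)"
proof (rule summable_comparison_test')
  \<comment> \<open>Differentiating the geometric series twice produces the coefficients (n + 1) (n
    + 2).\<close>
  have 1: "summable (\<lambda>n. diffs (\<lambda>_. 1) n * z ^ n)" if "norm z < 1" for z :: real
    by (rule termdiff_converges[OF that]) (simp add: summable_geometric)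
  have "summable (\<lambda>n. diffs (diffs (\<lambda>_. 1)) n * x ^ n)"
    by (rule termdiff_converges[of _ 1]) (use 1 assms in auto)
  then have "summable (\<lambda>n. diffs (diffs (\<lambda>_. 1)) n * x ^ n / (1 - x))"
    by (rule summable_divide)
  then show "summable (\<lambda>N. real (Suc N) * (real (N + 2) * x ^ N / (1 - x)))"
    by (simp add: diffs_def mult_ac)
  fix N
  show "norm (real (Suc N) * \<bar>level_dev x (Suc r) N\<bar>) \<le> real (Suc N) * (real (N + 2) * x ^ N / (1 - x))"
    using mult_left_mono[OF abs_level_dev_le[OF assms, of r N], of "real (Suc N)"] by simp
qed

text \<open>The trace S at \<open>Suc r\<close> and N determines both neighbours:
  \<open>level_sum_Suc\<close> gives the trace at \<open>Suc N\<close>, \<open>level_dev_eq\<close>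
  the deviation at \<open>Suc (Suc r)\<close>. Both contain \<open>(1 + X * S) / u\<close>, which
  links them.\<close>

lemma level_dev_rec:
  assumes "0 < x" "x < 1"
  shows "(1 - x ^ Suc r) * x * level_dev x (Suc (Suc r)) N =
    level_dev x (Suc r) (Suc N) - x ^ Suc r * level_dev x (Suc r) N"
proof -
  define X where "X = x ^ Suc r"
  define y where "y = x ^ (N + 2)"
  define u where "u = 1 - X * y"
  define S where "S = level_trace x (Suc r) N"
  define p where "p = qprod x (Suc r) (N + 2)"
  define p' where "p' = qprod x (Suc r) (N + 3)"
  have X: "1 - X \<noteq> 0"
    unfolding X_def using power_Suc_less_one[OF assms] by (metis less_irrefl right_minus_eq)
  have "X * y = x ^ Suc (N + r + 2)"
    by (simp add: X_def y_def power_add mult_ac)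
  then have u: "u \<noteq> 0"
    unfolding u_def using power_Suc_less_one[OF assms] by (metis less_irrefl right_minus_eq)
  have p: "p > 0" "p' > 0"
    unfolding p_def p'_def using qprod_pos assms by auto
  \<comment> \<open>Both sides are \<open>qprod x (Suc (Suc r)) (N + 2)\<close>, split at the first
    and at the last factor.\<close>
  have py: "p' * (1 - y) = p * u"
    using qprod_Suc'[of x "Suc r" "N + 2"] qprod_Suc[of x "Suc r" "N + 2"]
    by (simp add: p_def p'_def u_def y_def X_def power_add mult_ac numeral_eq_Suc)
  have "level_sum x (Suc r) (Suc N) = p + X * level_sum x (Suc r) N"
    by (simp only: level_sum_Suc p_def X_def)
  also have "level_sum x (Suc r) N = S * p"
    using p by (simp add: S_def level_trace_eq p_def)
  finally have "p' * level_trace x (Suc r) (Suc N) = p + X * (S * p)"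
    using p by (simp add: level_trace_eq p'_def numeral_eq_Suc)
  then have "p' * (u * level_trace x (Suc r) (Suc N)) = p * u * (1 + X * S)"
    by (simp add: mult.left_commute[of p' u]) (simp add: algebra_simps)
  also have "\<dots> = p' * ((1 - y) * (1 + X * S))"
    by (simp only: py[symmetric] mult.assoc)
  finally have "u * level_trace x (Suc r) (Suc N) = (1 - y) * (1 + X * S)"
    using p by simp
  then have S': "level_trace x (Suc r) (Suc N) = (1 - y) * (1 + X * S) / u"
    using u by (simp add: field_simps)
  have L: "x * level_dev x (Suc (Suc r)) N = - (y * (1 + X * S) / u)"
    unfolding level_dev_eq[OF assms]
    by (simp add: X_def S_def y_def u_def power_add mult_ac numeral_eq_Suc)
  \<comment> \<open>The two limits combine to
    \<open>- 1 / (1 - X) + X / (1 - X) = - 1\<close>.\<close>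
  have "level_dev x (Suc r) (Suc N) - X * level_dev x (Suc r) N = (1 - y) * (1 + X * S) / u - X * S - 1"
  proof -
    have "(1 - X) * (1 / (1 - X)) = 1" using X by simp
    then show ?thesis
      unfolding level_dev_def S' S_def[symmetric] X_def[symmetric] by algebra
  qed
  also have "\<dots> = (1 - X) * - (y * (1 + X * S) / u)"
    using u by (simp add: divide_simps) (simp add: u_def algebra_simps)
  also have "\<dots> = (1 - X) * (x * level_dev x (Suc (Suc r)) N)"
    by (simp only: L)
  finally have "(1 - X) * (x * level_dev x (Suc (Suc r)) N) =
      level_dev x (Suc r) (Suc N) - X * level_dev x (Suc r) N" ..
  then show ?thesis
    by (simp add: X_def mult_ac)
qed

lemma summable_level_dev':
  assumes "0 < x" "x < 1"
  shows "summable (level_dev x (Suc r))"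
proof (rule summable_comparison_test'[OF summable_level_dev[OF assms, of r]])
  show "norm (level_dev x (Suc r) N) \<le> real (Suc N) * \<bar>level_dev x (Suc r) N\<bar>" for N
    using mult_right_mono[of 1 "real (Suc N)" "\<bar>level_dev x (Suc r) N\<bar>"] by simp
qed

lemma level_trace_0:
  assumes "0 < x" "x < 1"
  shows "level_trace x r 0 = (1 - x) / (1 - x ^ Suc r)"
proof -
  have "(1 - x) * qprod x r 2 = qprod x r 1 * (1 - x ^ Suc r)"
    using qprod_Suc'[of x r 1] qprod_Suc[of x r 1] by (simp add: numeral_2_eq_2)
  moreover have "1 - x ^ Suc r \<noteq> 0"
    using power_Suc_less_one[OF assms] by (metis less_irrefl right_minus_eq)
  moreover have "qprod x r 2 > 0"
    using qprod_pos assms by simp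
  ultimately show ?thesis
    by (simp add: level_trace_eq level_sum_0 divide_simps numeral_2_eq_2)
qed

text \<open>In the sum of \<open>level_dev_rec\<close> over N the shifted series only loses its term
  N = 0, so the factor 1 - X appears on both sides and cancels.\<close>

lemma suminf_level_dev_rec:
  assumes "0 < x" "x < 1"
  shows "x ^ Suc (Suc r) * (\<Sum>N. level_dev x (Suc (Suc r)) N) =
    x ^ Suc r * (\<Sum>N. level_dev x (Suc r) N) - x ^ Suc r * level_dev x (Suc r) 0 / (1 - x ^ Suc r)"
proof -
  define X where "X = x ^ Suc r"
  define Z where "Z = (\<Sum>N. level_dev x (Suc r) N)"
  define Z' where "Z' = (\<Sum>N. level_dev x (Suc (Suc r)) N)"
  have X: "1 - X \<noteq> 0"
    unfolding X_def using power_Suc_less_one[OF assms] by (metis less_irrefl right_minus_eq)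
  have s: "summable (level_dev x (Suc r))" for r
    by (rule summable_level_dev'[OF assms])
  have "(1 - X) * x * Z' = (\<Sum>N. (1 - X) * x * level_dev x (Suc (Suc r)) N)"
    unfolding Z'_def by (rule suminf_mult[OF s, symmetric])
  also have "\<dots> = (\<Sum>N. level_dev x (Suc r) (Suc N) - X * level_dev x (Suc r) N)"
    unfolding X_def by (intro suminf_cong level_dev_rec assms)
  also have "\<dots> = (\<Sum>N. level_dev x (Suc r) (Suc N)) - (\<Sum>N. X * level_dev x (Suc r) N)"
    by (intro suminf_diff[symmetric] summable_mult s) (simp add: summable_Suc_iff s)
  also have "(\<Sum>N. level_dev x (Suc r) (Suc N)) = Z - level_dev x (Suc r) 0"
    unfolding Z_def by (rule suminf_split_head[OF s])
  also have "(\<Sum>N. X * level_dev x (Suc r) N) = X * Z"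
    unfolding Z_def by (rule suminf_mult[OF s])
  finally have "x * Z' = Z - level_dev x (Suc r) 0 / (1 - X)"
    using X by (simp add: field_simps)
  then have "X * (x * Z') = X * Z - X * level_dev x (Suc r) 0 / (1 - X)"
    by (simp add: right_diff_distrib)
  then show ?thesis
    by (simp add: X_def Z_def Z'_def mult_ac)
qed

lemma suminf_level_dev_1:
  assumes "0 < x" "x < 1"
  shows "x * (\<Sum>N. level_dev x 1 N) = x / (1 - x) - G x"
proof -
  define f where "f = (\<lambda>n. real (Suc n) * x ^ Suc n * inverse (1 - x ^ Suc n))"
  have s: "summable (level_dev x 1)"
    using summable_level_dev'[OF assms, of 0] by simp
  have f: "f (Suc n) = - x * level_dev x 1 n" for n
    using level_dev_1[OF assms, of n] by (simp add: f_def)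
  have "summable (\<lambda>n. f (Suc n))"
    unfolding f by (intro summable_mult s)
  then have "summable f"
    by (simp add: summable_Suc_iff)
  then have "(\<Sum>n. f (Suc n)) = G x - f 0"
    unfolding G_def f_def[symmetric] by (rule suminf_split_head)
  moreover have "(\<Sum>n. f (Suc n)) = - x * (\<Sum>n. level_dev x 1 n)"
    unfolding f by (rule suminf_mult[OF s])
  ultimately show ?thesis
    by (simp add: f_def divide_inverse)
qed

subsection \<open>Continuation of perturbed zeta series\<close>

text \<open>The difference of two continuations vanishes on a right half-plane, hence off a sparse
  subset of the common half-plane. As 0 might be exceptional, its value is recovered as a limit, by
  analyticity at 0.\<close>

lemma trace_value_at_0_unique:
  assumes "trace_value_at_0 T v" "trace_value_at_0 T v'"
  shows "v = v'"
proof -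
  obtain g \<tau> \<sigma> where g: "\<tau> < 0" "g meromorphic_on {s. Re s > \<tau>}" "g analytic_on {0}" "g 0 = v"
      "\<And>s. Re s > \<sigma> \<Longrightarrow> has_trace (T s) (g s)"
    using assms(1) unfolding trace_value_at_0_def by blast
  obtain g' \<tau>' \<sigma>' where g': "\<tau>' < 0" "g' meromorphic_on {s. Re s > \<tau>'}" "g' analytic_on {0}" "g' 0 = v'"
      "\<And>s. Re s > \<sigma>' \<Longrightarrow> has_trace (T s) (g' s)"
    using assms(2) unfolding trace_value_at_0_def by blast
  define h where "h = (\<lambda>s. g s - g' s)"
  define A where "A = {s. Re s > max \<tau> \<tau>'}"
  \<comment> \<open>Including \<tau> and \<tau>' puts the test point m + 1 into
    \<open>A\<close>.\<close>
  define m where "m = max (max \<sigma> \<sigma>') (max \<tau> \<tau>')"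
  have A: "open A" "connected A"
    unfolding A_def by (intro open_halfspace_Re_gt convex_connected convex_halfspace_Re_gt)+
  have mero: "h meromorphic_on A"
    unfolding h_def by (intro meromorphic_on_diff meromorphic_on_subset[OF g(2)] meromorphic_on_subset[OF g'(2)])
      (auto simp: A_def)
  have zero: "h s = 0" if "Re s > m" for s
    using g(5)[of s] g'(5)[of s] that has_sum_unique
    by (fastforce simp: h_def m_def has_trace_def)
  have "\<not> eventually (\<lambda>s. h s \<noteq> 0) (cosparse A)"
  proof
    assume *: "eventually (\<lambda>s. h s \<noteq> 0) (cosparse A)"
    define z where "z = complex_of_real (m + 1)"
    have "z \<in> A" by (auto simp: A_def z_def m_def)
    then have "eventually (\<lambda>s. h s \<noteq> 0) (at z)"
      using * A by (simp add: eventually_cosparse_open_eq)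
    moreover have "eventually (\<lambda>s. s \<in> {s. Re s > m}) (at z)"
      by (rule eventually_at_in_open') (auto simp: open_halfspace_Re_gt z_def)
    ultimately have "eventually (\<lambda>s. False) (at z)"
      by eventually_elim (use zero in auto)
    then show False by simp
  qed
  then have "eventually (\<lambda>s. h s = 0) (cosparse A)"
    using meromorphic_imp_constant_or_avoid[OF mero A, of 0] by blast
  then have "eventually (\<lambda>s. h s = 0) (at 0)"
    using A g(1) g'(1) by (simp add: eventually_cosparse_open_eq A_def)
  then have "(h \<longlongrightarrow> 0) (at 0)"
    by (rule tendsto_eventually)
  moreover have "(h \<longlongrightarrow> h 0) (at 0)"
    using analytic_at_imp_isCont[of h 0] g(3) g'(3)
    by (auto simp: h_def analytic_on_diff isCont_def)
  ultimately have "h 0 = 0"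
    using LIM_unique by blast
  then show ?thesis by (simp add: h_def g(4) g'(4))
qed

text \<open>
  \<open>s - 1\<close> times the error of the trapezoidal rule for the integral of \<open>t\<^sup>-\<^sup>s\<close> over \<open>[n, n + 1]\<close>; the factor \<open>s - 1\<close>
  removes the singularity, and the second-order error gives convergence beyond \<open>Re s = 0\<close>.
\<close>

definition zeta_term :: "nat \<Rightarrow> complex \<Rightarrow> complex" where
  "zeta_term n s = (s - 1) * (of_nat n powr - s + of_nat (Suc n) powr - s) / 2
     + of_nat (Suc n) powr (1 - s) - of_nat n powr (1 - s)"

text \<open>As a function of the right endpoint t, the error \<open>f 0\<close> vanishes at t = n
  together with its derivative \<open>f 1\<close>, and its second derivative is the last branch of
  \<open>f\<close>. Taylor's formula on the unit segment gives the bound.\<close>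

lemma norm_zeta_term_le:
  assumes n: "n \<ge> 1" and s: "Re s \<ge> - (1/2)"
  shows "norm (zeta_term n s) \<le> norm s * norm (s - 1) * norm (s + 1) * real n powr - (3/2)"
proof -
  define a where "a = complex_of_nat n"
  define f where "f = (\<lambda>(i::nat) t. if i = 0 then (s - 1) / 2 * (a powr - s + t powr - s) * (t - a) + t powr (1 - s) - a powr (1 - s)
     else if i = 1 then (s - 1) / 2 * (a powr - s + t powr - s) + (s - 1) / 2 * (- s * t powr (- s - 1)) * (t - a) + (1 - s) * t powr - s
     else s * (s - 1) * (s + 1) / 2 * t powr (- s - 2) * (t - a) :: complex)"
  define S where "S = closed_segment a (a + 1)"
  have S: "\<exists>u. t = of_real u \<and> real n \<le> u \<and> u \<le> real n + 1" if "t \<in> S" for t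
  proof -
    have "S = of_real ` closed_segment (real n) (real n + 1)"
      unfolding S_def a_def by (subst closed_segment_of_real[symmetric]) simp
    then show ?thesis using that by (auto simp: closed_segment_eq_real_ivl)
  qed
  have nz: "t \<notin> \<real>\<^sub>\<le>\<^sub>0" if "t \<in> S" for t
    using S[OF that] n by auto
  define K where "K = norm s * norm (s - 1) * norm (s + 1) * real n powr - (3/2)"
  have "norm (f 0 (a + 1) - (\<Sum>i\<le>(1::nat). f i a * ((a + 1) - a) ^ i / fact i)) \<le> K * norm ((a + 1) - a) ^ Suc 1 / fact 1"
  proof (rule complex_Taylor[where S = S])
    show "convex S" "a \<in> S" "a + 1 \<in> S"
      by (auto simp: S_def)
    fix t assume t: "t \<in> S"
    obtain u where u: "t = of_real u" "real n \<le> u" "u \<le> real n + 1"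
      using S[OF t] by blast
    have "norm (t powr (- s - 2)) = u powr (- Re s - 2)"
      using u n by (simp add: norm_powr_real_powr)
    \<comment> \<open>The hypothesis Re s >= -1/2 makes the exponent at most -3/2, which is
      summable.\<close>
    also have "\<dots> \<le> u powr - (3/2)"
    proof (rule powr_mono)
      show "- Re s - 2 \<le> - (3 / 2)" using s by (simp add: field_simps)
      show "1 \<le> u" using u n by linarith
    qed
    also have "\<dots> \<le> real n powr - (3/2)"
      using u n by (intro powr_mono2') auto
    finally have 1: "norm (t powr (- s - 2)) \<le> real n powr - (3/2)" .
    have "t - a = of_real (u - real n)"
      by (simp add: u a_def)
    then have 2: "norm (t - a) \<le> 1"
      using u by (simp only: norm_of_real)
    have "norm (f (Suc 1) t) = norm s * norm (s - 1) * norm (s + 1) * (norm (t powr (- s - 2)) * norm (t - a)) / 2"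
      by (simp add: f_def norm_mult norm_divide)
    also have "\<dots> \<le> norm s * norm (s - 1) * norm (s + 1) * (real n powr - (3/2) * 1) / 1"
      by (intro frac_le mult_mono mult_nonneg_nonneg) (use 1 2 in auto)
    finally show "norm (f (Suc 1) t) \<le> K"
      by (simp add: K_def)
    fix i :: nat assume "i \<le> 1"
    then consider "i = 0" | "i = 1" by linarith
    then show "(f i has_field_derivative f (Suc i) t) (at t within S)"
    proof cases
      case 1
      have "((\<lambda>t. (s - 1) / 2 * (a powr - s + t powr - s) * (t - a) + t powr (1 - s) - a powr (1 - s))
         has_field_derivative ((s - 1) / 2 * (a powr - s + t powr - s) + (s - 1) / 2 * (- s * t powr (- s - 1)) * (t - a) + (1 - s) * t powr - s)) (at t within S)"
        by (rule derivative_eq_intros refl has_field_derivative_powr[THEN has_field_derivative_at_within] | use nz[OF t] in simp)+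
      then show ?thesis using 1 by (simp add: f_def)
    next
      case 2
      define u where "u = t powr (- s - 1)"
      define v where "v = t powr (- s - 2)"
      have p: "((\<lambda>t. t powr - s) has_field_derivative - s * u) (at t within S)"
        unfolding u_def by (rule has_field_derivative_powr[THEN has_field_derivative_at_within, OF nz[OF t]])
      have "((\<lambda>t. t powr (- s - 1)) has_field_derivative (- s - 1) * t powr (- s - 1 - 1)) (at t within S)"
        by (rule has_field_derivative_powr[THEN has_field_derivative_at_within, OF nz[OF t]])
      then have p': "((\<lambda>t. t powr (- s - 1)) has_field_derivative (- s - 1) * v) (at t within S)"
        by (simp add: v_def diff_diff_eq)
      have "((\<lambda>t. (s - 1) / 2 * (a powr - s + t powr - s) + (s - 1) / 2 * (- s * t powr (- s - 1)) * (t - a) + (1 - s) * t powr - s)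
         has_field_derivative (s * (s - 1) * (s + 1) / 2 * t powr (- s - 2) * (t - a))) (at t within S)"
        by (rule derivative_eq_intros p p' refl)+
          (simp add: u_def[symmetric] v_def[symmetric] algebra_simps add_divide_distrib diff_divide_distrib)
      then show ?thesis using 2 by (simp add: f_def)
    qed
  qed
  moreover have "f 0 (a + 1) - (\<Sum>i\<le>(1::nat). f i a * ((a + 1) - a) ^ i / fact i) = zeta_term n s"
    by (simp add: f_def zeta_term_def a_def field_simps)
  ultimately show ?thesis
    by (simp add: K_def)
qed

text \<open>The powers with exponent 1 - s telescope to -1; the left and right endpoint values sum
  to Z and Z - 1.\<close>

lemma sums_zeta_term:
  assumes s: "Re s > 1" and Z: "(\<lambda>n. of_nat (Suc n) powr - s) sums Z"
  shows "(\<lambda>n. zeta_term (Suc n) s) sums ((s - 1) * (Z - 1/2) - 1)"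
proof -
  have "(\<lambda>n. real (Suc n) powr (1 - Re s)) \<longlonglongrightarrow> 0"
    by (rule tendsto_neg_powr) (use s in \<open>simp_all add: filterlim_compose[OF filterlim_real_sequentially filterlim_Suc] del: of_nat_Suc\<close>)
  then have "(\<lambda>n. norm (of_nat (Suc n) powr (1 - s) :: complex)) \<longlonglongrightarrow> 0"
    by (subst norm_powr_real_powr) auto
  then have "(\<lambda>n. of_nat (Suc n) powr (1 - s) :: complex) \<longlonglongrightarrow> 0"
    by (simp only: tendsto_norm_zero_iff)
  then have "(\<lambda>n. of_nat (Suc (Suc n)) powr (1 - s) - of_nat (Suc n) powr (1 - s)) sums (0 - of_nat (Suc 0) powr (1 - s))"
    by (rule telescope_sums)
  moreover have "(\<lambda>n. of_nat (Suc (Suc n)) powr - s) sums (Z - of_nat (Suc 0) powr - s)"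
    using Z sums_Suc_iff[of "\<lambda>n. of_nat (Suc n) powr - s"] by simp
  then have "(\<lambda>n. (s - 1) / 2 * (of_nat (Suc n) powr - s + of_nat (Suc (Suc n)) powr - s)) sums
      ((s - 1) / 2 * (Z + (Z - of_nat (Suc 0) powr - s)))"
    by (intro sums_mult sums_add Z)
  ultimately have "(\<lambda>n. (s - 1) / 2 * (of_nat (Suc n) powr - s + of_nat (Suc (Suc n)) powr - s)
     + (of_nat (Suc (Suc n)) powr (1 - s) - of_nat (Suc n) powr (1 - s))) sums
      ((s - 1) / 2 * (Z + (Z - of_nat (Suc 0) powr - s)) + (0 - of_nat (Suc 0) powr (1 - s)))"
    by (intro sums_add)
  then show ?thesis
    by (simp add: zeta_term_def field_simps)
qed

text \<open>The eigenvalue of \<open>absD_power c (- s)\<close> at the tips of level N; N = 0 is the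
  kernel of \<open>D\<close>.\<close>

definition weight :: "real \<Rightarrow> complex \<Rightarrow> nat \<Rightarrow> complex" where
  "weight c s N = of_real (if N = 0 then c else real N) powr - s"

text \<open>For n >= 1 the coefficient is split into C, which multiplies zeta, and the rest, whose
  series converges beyond 0 by itself. The term n = 0 is kept apart because its base is c.\<close>

lemma dirichlet_continuation:
  fixes a :: "nat \<Rightarrow> real" and C c :: real
  assumes c: "c > 0" and sm: "summable (\<lambda>n. real (Suc n) * \<bar>a n - C\<bar>)"
  shows "\<exists>g. g meromorphic_on {s. Re s > - (1/2)} \<and> g analytic_on {0} \<and>
    g 0 = of_real ((\<Sum>n. a n - C) + C / 2) \<and>
    (\<forall>s. Re s > 1 \<longrightarrow> summable (\<lambda>n. norm (weight c s n * of_real (a n))) \<and>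
       (\<lambda>n. weight c s n * of_real (a n)) sums g s)"
proof -
  define w where "w = (\<lambda>s n. weight c s n * of_real (a n))"
  define D where "D = {s. Re s > - (1/2)}"
  have D: "open D"
    unfolding D_def by (rule open_halfspace_Re_gt)
  have sm': "summable (\<lambda>n. a n - C)"
  proof (rule summable_comparison_test'[OF sm])
    show "norm (a n - C) \<le> real (Suc n) * \<bar>a n - C\<bar>" for n
      using mult_right_mono[of 1 "real (Suc n)" "\<bar>a n - C\<bar>"] by simp
  qed
  obtain F where F: "\<forall>s\<in>D. ((\<lambda>n. zeta_term (Suc n) s) sums F s) \<and> F field_differentiable (at s)"
  proof (rule series_differentiable_comparison_complex[OF D, of "\<lambda>n. zeta_term (Suc n)"])
    show "zeta_term (Suc n) field_differentiable (at s)" for n s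
    proof -
      have "zeta_term (Suc n) holomorphic_on UNIV"
        unfolding zeta_term_def by (intro holomorphic_intros) auto
      then show ?thesis
        by (simp add: holomorphic_on_open field_differentiable_def)
    qed
    fix x assume "x \<in> D"
    \<comment> \<open>On the unit ball about x each of \<open>norm y\<close>,
      \<open>norm (y - 1)\<close> and \<open>norm (y + 1)\<close> is at most
      \<open>norm x + 2\<close>.\<close>
    define K where "K = (norm x + 2) ^ 3"
    define h where "h = (\<lambda>n. complex_of_real (K * real (Suc n) powr - (3/2)))"
    have "summable (\<lambda>n. real n powr - (3/2))"
      by (subst summable_real_powr_iff) simp
    then have "summable (\<lambda>n. K * real (Suc n) powr - (3/2))"
      by (intro summable_mult) (subst summable_Suc_iff)
    then have "summable h"
      unfolding h_def by (simp only: summable_of_real)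
    moreover have "range h \<subseteq> \<real>\<^sub>\<ge>\<^sub>0"
      by (auto simp: h_def K_def)
    moreover have "norm (zeta_term (Suc n) y) \<le> norm (h n)" if "y \<in> ball x 1 \<inter> D" for n y
    proof -
      have y: "norm y \<le> norm x + 1"
        using that norm_triangle_ineq2[of y x] by (simp add: dist_norm norm_minus_commute)
      have "norm (zeta_term (Suc n) y) \<le> norm y * norm (y - 1) * norm (y + 1) * real (Suc n) powr - (3/2)"
        by (rule norm_zeta_term_le) (use that in \<open>auto simp: D_def\<close>)
      also have "\<dots> \<le> (norm x + 2) * (norm x + 2) * (norm x + 2) * real (Suc n) powr - (3/2)"
        using y norm_triangle_ineq4[of y 1] norm_triangle_ineq[of y 1]
        by (intro mult_mono mult_nonneg_nonneg) auto
      also have "\<dots> = norm (h n)"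
        unfolding h_def norm_of_real by (simp add: K_def power3_eq_cube abs_mult)
      finally show ?thesis .
    qed
    ultimately show "\<exists>d h. 0 < d \<and> summable h \<and> range h \<subseteq> \<real>\<^sub>\<ge>\<^sub>0 \<and>
        (\<forall>\<^sub>F n in sequentially. \<forall>y\<in>ball x d \<inter> D. norm (zeta_term (Suc n) y) \<le> cmod (h n))"
      by (intro exI[of _ "1::real"] exI[of _ h]) auto
  qed (rule that)
  define v where "v = (\<lambda>n s. complex_of_nat (Suc n) powr - s * of_real (a (Suc n) - C))"
  \<comment> \<open>For Re s >= -1 the power is at most \<open>Suc n\<close>; the weight in
    \<open>sm\<close> pays for it.\<close>
  have norm_v: "norm (v n s) \<le> real (Suc (Suc n)) * \<bar>a (Suc n) - C\<bar>" if "Re s \<ge> -1" for n s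
  proof -
    have "norm (complex_of_nat (Suc n) powr - s) = real (Suc n) powr (- Re s)"
      by (subst norm_powr_real_powr) auto
    also have "\<dots> \<le> real (Suc n) powr 1"
      using that by (intro powr_mono) auto
    also have "\<dots> \<le> real (Suc (Suc n))"
      by simp
    finally show ?thesis
      unfolding v_def norm_mult by (intro mult_mono) (auto simp del: of_real_diff)
  qed
  have smv: "summable (\<lambda>n. real (Suc (Suc n)) * \<bar>a (Suc n) - C\<bar>)"
    using summable_Suc_iff[of "\<lambda>n. real (Suc n) * \<bar>a n - C\<bar>"] sm by simp
  obtain E where E: "\<forall>s\<in>D. ((\<lambda>n. v n s) sums E s) \<and> E field_differentiable (at s)"
  proof (rule series_differentiable_comparison_complex[OF D, of v])
    show "v n field_differentiable (at s)" for n s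
    proof -
      have "v n holomorphic_on UNIV"
        unfolding v_def by (auto intro!: holomorphic_intros)
      then show ?thesis
        by (simp add: holomorphic_on_open field_differentiable_def)
    qed
    fix x assume "x \<in> D"
    define h where "h = (\<lambda>n. complex_of_real (real (Suc (Suc n)) * \<bar>a (Suc n) - C\<bar>))"
    have "summable h"
      unfolding h_def by (rule summable_of_real[OF smv])
    moreover have "range h \<subseteq> \<real>\<^sub>\<ge>\<^sub>0"
      unfolding h_def by (auto simp del: of_real_mult)
    moreover have "norm (v n y) \<le> norm (h n)" if "y \<in> ball x 1 \<inter> D" for n y
      using norm_v[of y n] that unfolding h_def norm_of_real by (auto simp: D_def abs_mult)
    ultimately show "\<exists>d h. 0 < d \<and> summable h \<and> range h \<subseteq> \<real>\<^sub>\<ge>\<^sub>0 \<and>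
        (\<forall>\<^sub>F n in sequentially. \<forall>y\<in>ball x d \<inter> D. norm (v n y) \<le> cmod (h n))"
      by (intro exI[of _ "1::real"] exI[of _ h]) auto
  qed (rule that)
  \<comment> \<open>The quotient is zeta, from solving \<open>sums_zeta_term\<close> for Z; it can
    have a pole only at s = 1.\<close>
  define g where "g = (\<lambda>s. of_real c powr - s * of_real (a 0)
     + of_real C * ((1 + (s - 1) / 2 + F s) / (s - 1)) + E s)"
  have "(\<lambda>s. of_real c powr - s) holomorphic_on D"
    using c by (intro holomorphic_intros) auto
  then have an: "F analytic_on D" "E analytic_on D" "(\<lambda>s. of_real c powr - s) analytic_on D"
    using F E D by (auto simp: analytic_on_open holomorphic_on_def field_differentiable_at_within)
  have mero: "g meromorphic_on D"
    unfolding g_def by (intro meromorphic_intros analytic_on_imp_meromorphic_on an)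
  have ana: "g analytic_on {0}"
  proof -
    have 0: "{0} \<subseteq> D" by (simp add: D_def)
    show ?thesis
      unfolding g_def by (intro analytic_intros an[THEN analytic_on_subset[OF _ 0]]) auto
  qed
  have "g 0 = of_real ((\<Sum>n. a n - C) + C / 2)"
  proof -
    have 0: "0 \<in> D" by (simp add: D_def)
    \<comment> \<open>At s = 0 the integrand is constant and the trapezoidal rule exact; so F 0 = 0,
      and the quotient in \<open>g\<close> is -1/2.\<close>
    have "zeta_term (Suc n) 0 = 0" for n
    proof -
      have "zeta_term (Suc n) 0 = - 1 + of_nat (Suc (Suc n)) - of_nat (Suc n)"
        unfolding zeta_term_def by (simp del: of_nat_Suc)
      then show ?thesis by simp
    qed
    then have "(\<lambda>n. zeta_term (Suc n) 0) = (\<lambda>_. 0)"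
      by blast
    then have F0: "F 0 = 0"
      using bspec[OF F 0] sums_unique2[OF sums_zero, of "F 0"] by simp
    have "v n 0 = of_real (a (Suc n) - C)" for n
      by (simp add: v_def del: of_nat_Suc)
    then have E0: "(\<lambda>n. complex_of_real (a (Suc n) - C)) sums E 0"
      using bspec[OF E 0] by (simp del: of_real_diff)
    have "(\<lambda>n. complex_of_real (a (Suc n) - C)) sums of_real (\<Sum>n. a (Suc n) - C)"
      unfolding sums_of_real_iff using sm' summable_Suc_iff[of "\<lambda>n. a n - C"] by (auto simp: summable_sums)
    note sums_unique2[OF E0 this] F0
    moreover have "(\<Sum>n. a (Suc n) - C) = (\<Sum>n. a n - C) - (a 0 - C)"
      by (rule suminf_split_head[OF sm'])
    ultimately show ?thesis
      using c by (simp add: g_def)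
  qed
  moreover have "summable (\<lambda>n. norm (w s n)) \<and> w s sums g s" if s: "Re s > 1" for s
  proof -
    have sD: "s \<in> D" using s by (simp add: D_def)
    have "summable (\<lambda>n. real n powr - Re s)"
      using s by (subst summable_real_powr_iff) simp
    then have "summable (\<lambda>n. real (Suc n) powr - Re s)"
      by (subst summable_Suc_iff)
    moreover have "norm (complex_of_nat (Suc n) powr - s) = real (Suc n) powr (- Re s)" for n
      by (subst norm_powr_real_powr) auto
    ultimately have smz: "summable (\<lambda>n. norm (complex_of_nat (Suc n) powr - s))"
      by simp
    define Z where "Z = (\<Sum>n. complex_of_nat (Suc n) powr - s)"
    have Z: "(\<lambda>n. of_nat (Suc n) powr - s) sums Z"
      unfolding Z_def by (rule summable_sums[OF summable_norm_cancel[OF smz]])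
    have "F s = (s - 1) * (Z - 1/2) - 1"
      using sums_unique2[OF _ sums_zeta_term[OF s Z], of "F s"] bspec[OF F sD] by blast
    moreover have "s - 1 \<noteq> 0" using s by auto
    ultimately have FZ: "(1 + (s - 1) / 2 + F s) / (s - 1) = Z"
      by (simp add: field_simps)
    have w: "w s (Suc n) = of_real C * (of_nat (Suc n) powr - s) + v n s" for n
      by (simp add: w_def weight_def v_def algebra_simps)
    have "(\<lambda>n. w s (Suc n)) sums (of_real C * Z + E s)"
      unfolding w using E sD by (intro sums_add sums_mult Z) auto
    then have "w s sums (of_real C * Z + E s + w s 0)"
      by (simp add: sums_Suc_iff)
    moreover have "summable (\<lambda>n. norm (w s (Suc n)))"
    proof (rule summable_comparison_test')
      show "summable (\<lambda>n. \<bar>C\<bar> * norm (complex_of_nat (Suc n) powr - s) + real (Suc (Suc n)) * \<bar>a (Suc n) - C\<bar>)"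
        by (intro summable_add summable_mult smz smv)
      show "norm (norm (w s (Suc n))) \<le> \<bar>C\<bar> * norm (complex_of_nat (Suc n) powr - s) + real (Suc (Suc n)) * \<bar>a (Suc n) - C\<bar>" for n
        unfolding w real_norm_def abs_norm_cancel
        by (rule order.trans[OF norm_triangle_ineq])
          (use norm_v[of s n] s in \<open>auto simp: norm_mult simp del: of_nat_Suc\<close>)
    qed
    then have "summable (\<lambda>n. norm (w s n))"
      using summable_Suc_iff[of "\<lambda>n. norm (w s n)"] by blast
    ultimately show ?thesis
      unfolding g_def FZ by (simp add: w_def weight_def add_ac)
  qed
  ultimately show ?thesis
    using mero ana unfolding D_def w_def by (intro exI[of _ g] conjI allI impI) simp_all
qed

subsection \<open>The operator and its adjoint\<close>

text \<open>The naturals N = 2n, a = n + i, b = n + j replace the half-integers; a and b range over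
  0, ..., N.\<close>

lemma idxE:
  assumes "(n, i, j) \<in> idx"
  obtains N a b where "2 * n = real N" "n + i = real a" "n + j = real b" "a \<le> N" "b \<le> N"
proof -
  obtain N a b a' b' where *: "2 * n = real N" "n + i = real a" "n + j = real b"
      "n - i = real a'" "n - j = real b'"
    using assms by (auto simp: idx_def elim!: Nats_cases)
  then have "real N = real a + real a'" "real N = real b + real b'"
    by linarith+
  then have "a \<le> N" "b \<le> N" by linarith+
  then show ?thesis using that * by blast
qed

lemma idxI:
  assumes "2 * n = real N" "n + i = real a" "n + j = real b" "a \<le> N" "b \<le> N"
  shows "(n, i, j) \<in> idx"
proof -
  have "n - i = real (N - a)" "n - j = real (N - b)"
    using assms by (auto simp: of_nat_diff)
  then show ?thesis
    unfolding idx_def mem_Collect_eq prod.case using assms of_nat_in_Nats by metis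
qed

text \<open>The shifts act on all triples, so that they are bijections and sums over
  \<open>UNIV\<close> can be reindexed along them.\<close>

definition up :: "index \<Rightarrow> index" where
  "up = (\<lambda>(n, i, j). (n + 1/2, i + 1/2, j - 1/2))"

definition down :: "index \<Rightarrow> index" where
  "down = (\<lambda>(n, i, j). (n - 1/2, i + 1/2, j - 1/2))"

definition up_inv :: "index \<Rightarrow> index" where
  "up_inv = (\<lambda>(n, i, j). (n - 1/2, i - 1/2, j + 1/2))"

definition down_inv :: "index \<Rightarrow> index" where
  "down_inv = (\<lambda>(n, i, j). (n + 1/2, i - 1/2, j + 1/2))"

lemmas shift_defs = up_def down_def up_inv_def down_inv_def

lemma shift_inverse [simp]:
  "up (up_inv x) = x" "up_inv (up x) = x" "down (down_inv x) = x" "down_inv (down x) = x"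
  by (auto simp: shift_defs split: prod.splits)

lemma bij_shift: "bij up" "bij down" "bij up_inv" "bij down_inv"
  by (rule o_bij[where g = up_inv], auto simp: fun_eq_iff)
     (rule o_bij[where g = down_inv], auto simp: fun_eq_iff,
      rule o_bij[where g = up], auto simp: fun_eq_iff,
      rule o_bij[where g = down], auto simp: fun_eq_iff)

lemma up_idx: "x \<in> idx \<Longrightarrow> up x \<in> idx"
proof -
  assume "x \<in> idx"
  then obtain n i j where x: "x = (n, i, j)" "(n, i, j) \<in> idx" by (cases x) auto
  from x(2) obtain N a b where "2 * n = real N" "n + i = real a" "n + j = real b" "a \<le> N" "b \<le> N"
    by (rule idxE)
  then show ?thesis
    unfolding x up_def by (auto intro!: idxI[of _ "Suc N" _ "Suc a" _ b])
qed

lemma down_inv_idx: "x \<in> idx \<Longrightarrow> down_inv x \<in> idx"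
proof -
  assume "x \<in> idx"
  then obtain n i j where x: "x = (n, i, j)" "(n, i, j) \<in> idx" by (cases x) auto
  from x(2) obtain N a b where "2 * n = real N" "n + i = real a" "n + j = real b" "a \<le> N" "b \<le> N"
    by (rule idxE)
  then show ?thesis
    unfolding x down_inv_def by (auto intro!: idxI[of _ "Suc N" _ a _ "Suc b"])
qed

section \<open>Coefficients of \<open>beta q\<close>: zeros at the boundary and uniform
  bounds\<close>

definition coeff_up :: "real \<Rightarrow> index \<Rightarrow> real" where
  "coeff_up q = (\<lambda>(n, i, j). b_plus q n i j)"

definition coeff_down :: "real \<Rightarrow> index \<Rightarrow> real" where
  "coeff_down q = (\<lambda>(n, i, j). b_minus q n i j)"

lemma coeff_down_eq_0:
  assumes q: "0 < q" and "x \<in> idx" "down x \<notin> idx"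
  shows "coeff_down q x = 0"
proof -
  obtain n i j where x: "x = (n, i, j)" "(n, i, j) \<in> idx" using assms by (cases x) auto
  obtain N a b where n: "2 * n = real N" "n + i = real a" "n + j = real b" "a \<le> N" "b \<le> N"
    using x(2) by (rule idxE)
  have "n = 0 \<or> j = - n \<or> i = n"
  proof (rule ccontr)
    assume "\<not> ?thesis"
    then have "N \<noteq> 0" "b \<noteq> 0" "a \<noteq> N" using n by auto
    then have "down x \<in> idx"
      unfolding x down_def using n
      by (auto intro!: idxI[of _ "N - 1" _ a _ "b - 1"] simp: of_nat_diff)
    then show False using assms by blast
  qed
  then show ?thesis
    using q by (auto simp: x coeff_down_def b_minus_def)
qed

text \<open>The formula for \<open>b_plus\<close> is evaluated outside \<open>idx\<close>; at j = n
  or i = - n one of its square roots becomes that of 1 - q^0.\<close>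

lemma coeff_up_up_inv_eq_0:
  assumes q: "0 < q" and "x \<in> idx" "up_inv x \<notin> idx"
  shows "coeff_up q (up_inv x) = 0"
proof -
  obtain n i j where x: "x = (n, i, j)" "(n, i, j) \<in> idx" using assms by (cases x) auto
  obtain N a b where n: "2 * n = real N" "n + i = real a" "n + j = real b" "a \<le> N" "b \<le> N"
    using x(2) by (rule idxE)
  have "j = n \<or> i = - n"
  proof (rule ccontr)
    assume "\<not> ?thesis"
    then have "b \<noteq> N" "a \<noteq> 0" using n by auto
    then have "up_inv x \<in> idx"
      unfolding x up_inv_def using n
      by (auto intro!: idxI[of _ "N - 1" _ "a - 1" _ b] simp: of_nat_diff)
    then show False using assms by blast
  qed
  then show ?thesis
    using q by (auto simp: x coeff_up_def b_plus_def up_inv_def)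
qed

text \<open>The square roots in the numerator are at most 1, and the exponents in the denominator
  are at least 2. For \<open>b_minus\<close> the latter requires n > 0, hence the separate case N =
  0.\<close>

lemma coefficient_bounds:
  assumes q: "0 < q" "q < 1" and "x \<in> idx"
  shows "\<bar>coeff_up q x\<bar> \<le> 1 / (1 - q\<^sup>2)" "\<bar>coeff_down q x\<bar> \<le> 1 / (1 - q\<^sup>2)"
proof -
  obtain n i j where x: "x = (n, i, j)" "(n, i, j) \<in> idx" using assms by (cases x) auto
  obtain N a b where n: "2 * n = real N" "n + i = real a" "n + j = real b" "a \<le> N" "b \<le> N"
    using x(2) by (rule idxE)
  have q2: "0 < 1 - q\<^sup>2"
    using q by (simp add: power_less_one_iff)
  have frac: "\<bar>p * (sqrt (1 - q powr u) * sqrt (1 - q powr v)) / (sqrt (1 - q powr s) * sqrt (1 - q powr t))\<bar>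
      \<le> 1 / (1 - q\<^sup>2)"
    if "\<bar>p\<bar> \<le> 1" "u \<ge> 0" "v \<ge> 0" "s \<ge> 2" "t \<ge> 2" for p u v s t
  proof -
    have num: "0 \<le> sqrt (1 - q powr e)" "sqrt (1 - q powr e) \<le> 1" if "e \<ge> 0" for e
      using q that by (auto simp: powr_le1)
    have den: "sqrt (1 - q\<^sup>2) \<le> sqrt (1 - q powr e)" if "e \<ge> 2" for e
    proof -
      have "q powr e \<le> q powr 2" using q that by (intro powr_mono') auto
      then show ?thesis using q by (simp add: powr_numeral)
    qed
    have "\<bar>p * (sqrt (1 - q powr u) * sqrt (1 - q powr v)) / (sqrt (1 - q powr s) * sqrt (1 - q powr t))\<bar>
      = \<bar>p\<bar> * (sqrt (1 - q powr u) * sqrt (1 - q powr v)) / (sqrt (1 - q powr s) * sqrt (1 - q powr t))"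
      using num that by (simp add: abs_mult)
    also have "\<dots> \<le> 1 * (1 * 1) / (sqrt (1 - q\<^sup>2) * sqrt (1 - q\<^sup>2))"
      by (intro frac_le mult_mono mult_nonneg_nonneg mult_pos_pos num den) (use that q2 in auto)
    finally show ?thesis using q2 by simp
  qed
  have p1: "\<bar>q powr real m\<bar> \<le> 1" for m
    using q by (simp add: powr_le1)
  show "\<bar>coeff_up q x\<bar> \<le> 1 / (1 - q\<^sup>2)"
    unfolding x coeff_up_def b_plus_def prod.case
    by (intro frac) (use n p1[of b] in auto)
  show "\<bar>coeff_down q x\<bar> \<le> 1 / (1 - q\<^sup>2)"
  proof (cases "N = 0")
    case True
    then show ?thesis using q2 n by (simp add: x coeff_down_def b_minus_def)
  next
    case False
    then have "real N \<ge> 1" by simp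
    moreover have "n \<noteq> 0" using False n by auto
    ultimately have "\<bar>b_minus q n i j\<bar> \<le> 1 / (1 - q\<^sup>2)"
      unfolding b_minus_def if_not_P[OF \<open>n \<noteq> 0\<close>]
      by (intro frac) (use n p1[of a] in auto)
    then show ?thesis by (simp add: x coeff_down_def)
  qed
qed

definition beta_coord :: "real \<Rightarrow> vec \<Rightarrow> vec" where
  "beta_coord q f y = of_real (coeff_up q (up_inv y)) * f (up_inv y) + of_real (coeff_down q (down_inv y)) * f (down_inv y)"

definition beta_adj_coord :: "real \<Rightarrow> vec \<Rightarrow> vec" where
  "beta_adj_coord q f x = (if x \<in> idx then of_real (coeff_up q x) * f (up x) + of_real (coeff_down q x) * f (down x) else 0)"

lemma ell2D: "f \<in> ell2 \<Longrightarrow> x \<notin> idx \<Longrightarrow> f x = 0"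
  unfolding ell2_def mem_Collect_eq by blast

lemma ell2_iff: "f \<in> ell2 \<longleftrightarrow> (\<forall>x. x \<notin> idx \<longrightarrow> f x = 0) \<and> (\<lambda>x. (cmod (f x))\<^sup>2) summable_on UNIV"
  unfolding ell2_def mem_Collect_eq
  by (rule conj_cong[OF refl], rule summable_on_cong_neutral) auto

lemma ell2_summable: "f \<in> ell2 \<Longrightarrow> (\<lambda>x. (cmod (f x))\<^sup>2) summable_on UNIV"
  by (simp add: ell2_iff)

lemma ell2_summable_shift:
  assumes "f \<in> ell2" "bij \<sigma>"
  shows "(\<lambda>x. (cmod (f (\<sigma> x)))\<^sup>2) summable_on UNIV"
  using summable_on_reindex_bij_betw[OF assms(2), of "\<lambda>x. (cmod (f x))\<^sup>2"] ell2_summable[OF assms(1)]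
  by simp

lemma beta_eq:
  assumes "f \<in> ell2"
  shows "beta q f = beta_coord q f"
proof
  fix y
  let ?v = "\<lambda>(n, i, j) y. complex_of_real (b_plus q n i j) * ket (n + 1/2, i + 1/2, j - 1/2) y +
     of_real (b_minus q n i j) * ket (n - 1/2, i + 1/2, j - 1/2) y"
  have v: "?v x y = of_real (coeff_up q x) * ket (up x) y + of_real (coeff_down q x) * ket (down x) y" for x
    by (auto simp: coeff_up_def coeff_down_def up_def down_def split: prod.splits)
  have ne: "up_inv y \<noteq> down_inv y"
    by (auto simp: shift_defs split: prod.splits)
  have *: "ket (up x) y = (if x = up_inv y then 1 else 0)" "ket (down x) y = (if x = down_inv y then 1 else 0)" for x
    unfolding ket_def by (metis shift_inverse)+
  have "beta q f y = (\<Sum>\<^sub>\<infinity>x\<in>idx. f x * ?v x y)"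
    by (simp add: beta_def extend_op_def)
  also have "\<dots> = (\<Sum>\<^sub>\<infinity>x\<in>{up_inv y, down_inv y}. f x * ?v x y)"
    by (rule infsum_cong_neutral) (use ell2D[OF assms] in \<open>auto simp: v *\<close>)
  also have "\<dots> = beta_coord q f y"
    using ne unfolding v * by (simp add: beta_coord_def)
  finally show "beta q f y = beta_coord q f y" .
qed

text \<open>Rests on \<open>|u + v|^2 <= 2 |u|^2 + 2 |v|^2\<close>. Bounds are asked for only where
  f is nonzero, because the coefficient formulas are not controlled outside
  \<open>idx\<close>.\<close>

lemma ell2_add_shifts:
  assumes f: "f \<in> ell2" and \<sigma>: "bij \<sigma>" "bij \<tau>"
    and a: "\<And>x. f (\<sigma> x) \<noteq> 0 \<Longrightarrow> \<bar>a x\<bar> \<le> M" and b: "\<And>x. f (\<tau> x) \<noteq> 0 \<Longrightarrow> \<bar>b x\<bar> \<le> M"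
    and g: "\<And>x. x \<in> idx \<Longrightarrow> g x = of_real (a x) * f (\<sigma> x) + of_real (b x) * f (\<tau> x)"
    and g0: "\<And>x. x \<notin> idx \<Longrightarrow> g x = 0"
  shows "g \<in> ell2"
proof -
  have 1: "(cmod (of_real t * z))\<^sup>2 \<le> M\<^sup>2 * (cmod z)\<^sup>2" if "z \<noteq> 0 \<Longrightarrow> \<bar>t\<bar> \<le> M" for t :: real and z
  proof (cases "z = 0")
    case False
    then have "\<bar>t\<bar> * cmod z \<le> M * cmod z"
      using that by (intro mult_right_mono) auto
    then have "(\<bar>t\<bar> * cmod z)\<^sup>2 \<le> (M * cmod z)\<^sup>2"
      by (intro power_mono) auto
    then show ?thesis by (simp add: norm_mult power_mult_distrib)
  qed auto
  have "(cmod (g x))\<^sup>2 \<le> 2 * M\<^sup>2 * (cmod (f (\<sigma> x)))\<^sup>2 + 2 * M\<^sup>2 * (cmod (f (\<tau> x)))\<^sup>2" for x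
  proof (cases "x \<in> idx")
    case True
    let ?u = "of_real (a x) * f (\<sigma> x)" and ?v = "of_real (b x) * f (\<tau> x)"
    have "(cmod (?u + ?v))\<^sup>2 \<le> (cmod ?u + cmod ?v)\<^sup>2"
      by (intro power_mono norm_triangle_ineq) auto
    also have "\<dots> \<le> 2 * (cmod ?u)\<^sup>2 + 2 * (cmod ?v)\<^sup>2"
      using sum_squares_bound[of "cmod ?u" "cmod ?v"] by (simp add: power2_sum)
    also have "\<dots> \<le> 2 * M\<^sup>2 * (cmod (f (\<sigma> x)))\<^sup>2 + 2 * M\<^sup>2 * (cmod (f (\<tau> x)))\<^sup>2"
      using 1[of "f (\<sigma> x)" "a x", OF a] 1[of "f (\<tau> x)" "b x", OF b] by simp
    finally show ?thesis by (simp add: g[OF True])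
  qed (simp add: g0)
  moreover have "(\<lambda>x. 2 * M\<^sup>2 * (cmod (f (\<sigma> x)))\<^sup>2 + 2 * M\<^sup>2 * (cmod (f (\<tau> x)))\<^sup>2) summable_on UNIV"
    by (intro summable_on_add summable_on_cmult_right ell2_summable_shift f \<sigma>)
  ultimately have "(\<lambda>x. (cmod (g x))\<^sup>2) summable_on UNIV"
    by (rule_tac summable_on_comparison_test) auto
  then show ?thesis using g0 by (simp add: ell2_iff)
qed

lemma beta_coord_ell2:
  assumes "0 < q" "q < 1" "f \<in> ell2"
  shows "beta_coord q f \<in> ell2"
proof (rule ell2_add_shifts[OF assms(3) bij_shift(3,4)])
  show "\<bar>coeff_up q (up_inv x)\<bar> \<le> 1 / (1 - q\<^sup>2)" if "f (up_inv x) \<noteq> 0" for x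
    using that coefficient_bounds[OF assms(1,2)] ell2D[OF assms(3)] by blast
  show "\<bar>coeff_down q (down_inv x)\<bar> \<le> 1 / (1 - q\<^sup>2)" if "f (down_inv x) \<noteq> 0" for x
    using that coefficient_bounds[OF assms(1,2)] ell2D[OF assms(3)] by blast
  fix x assume x: "x \<notin> idx"
  then have "f (up_inv x) = 0"
    using up_idx[of "up_inv x"] ell2D[OF assms(3), of "up_inv x"] by auto
  moreover have "f (down_inv x) = 0 \<or> coeff_down q (down_inv x) = 0"
    using x coeff_down_eq_0[OF assms(1), of "down_inv x"] ell2D[OF assms(3), of "down_inv x"] by auto
  ultimately show "beta_coord q f x = 0"
    by (auto simp: beta_coord_def)
qed (simp add: beta_coord_def)

lemma beta_adj_coord_ell2:
  assumes "0 < q" "q < 1" "f \<in> ell2"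
  shows "beta_adj_coord q f \<in> ell2"
proof (rule ell2_add_shifts[OF assms(3) bij_shift(1,2), of "\<lambda>x. if x \<in> idx then coeff_up q x else 0" _ "\<lambda>x. if x \<in> idx then coeff_down q x else 0"])
  show "\<bar>if x \<in> idx then coeff_up q x else 0\<bar> \<le> 1 / (1 - q\<^sup>2)" for x
    using coefficient_bounds[OF assms(1,2), of x] assms by (auto simp: power_le_one)
  show "\<bar>if x \<in> idx then coeff_down q x else 0\<bar> \<le> 1 / (1 - q\<^sup>2)" for x
    using coefficient_bounds[OF assms(1,2), of x] assms by (auto simp: power_le_one)
qed (auto simp: beta_adj_coord_def)

section \<open>Inner products and the adjoint of \<open>beta q\<close>\<close>

lemma inner_prod_UNIV:
  assumes "f \<in> ell2"
  shows "inner_prod f g = (\<Sum>\<^sub>\<infinity>x. cnj (f x) * g x)" "inner_prod g f = (\<Sum>\<^sub>\<infinity>x. cnj (g x) * f x)"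
  unfolding inner_prod_def
  by (rule infsum_cong_neutral; use ell2D[OF assms] in auto)+

text \<open>By \<open>|f g| <= |f|^2 + |g|^2\<close> the two halves of the inner product converge
  absolutely and may be split and reindexed.\<close>

lemma summable_on_inner_shift:
  assumes f: "f \<in> ell2" and g: "g \<in> ell2" and \<sigma>: "bij \<sigma>"
    and a: "\<And>x. x \<in> idx \<Longrightarrow> \<bar>a x\<bar> \<le> M"
  shows "(\<lambda>x. cnj (f (\<sigma> x)) * (of_real (a x) * g x)) summable_on UNIV"
proof -
  have le: "cmod (cnj (f (\<sigma> x)) * (of_real (a x) * g x)) \<le> M * (cmod (f (\<sigma> x)))\<^sup>2 + M * (cmod (g x))\<^sup>2" for x
  proof (cases "x \<in> idx")
    case True
    let ?u = "cmod (f (\<sigma> x))" and ?v = "cmod (g x)"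
    have M: "0 \<le> M" using a[OF True] by simp
    have "cmod (cnj (f (\<sigma> x)) * (of_real (a x) * g x)) = \<bar>a x\<bar> * (?u * ?v)"
      by (simp add: norm_mult)
    also have "\<dots> \<le> M * (?u\<^sup>2 + ?v\<^sup>2)"
    proof (intro mult_mono a True M)
      have "0 \<le> ?u * ?v" by simp
      then show "?u * ?v \<le> ?u\<^sup>2 + ?v\<^sup>2"
        using sum_squares_bound[of ?u ?v] by linarith
    qed auto
    finally show ?thesis by (simp add: distrib_left)
  next
    case False
    have "idx \<noteq> {}" using idxI[of 0 0 0 0 0 0] by auto
    then have "0 \<le> M" using a by force
    then show ?thesis using False ell2D[OF g] by simp
  qed
  have "(\<lambda>x. M * (cmod (f (\<sigma> x)))\<^sup>2 + M * (cmod (g x))\<^sup>2) summable_on UNIV"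
    by (intro summable_on_add summable_on_cmult_right ell2_summable_shift ell2_summable f g \<sigma>)
  then have "(\<lambda>x. cmod (cnj (f (\<sigma> x)) * (of_real (a x) * g x))) summable_on UNIV"
    by (rule Infinite_Sum.abs_summable_on_comparison_test') (rule le)
  then show ?thesis by (rule abs_summable_summable)
qed

lemma inner_prod_beta_adj_coord:
  assumes q: "0 < q" "q < 1" and f: "f \<in> ell2" and g: "g \<in> ell2"
  shows "inner_prod (beta_adj_coord q f) g = inner_prod f (beta_coord q g)"
proof -
  let ?u = "\<lambda>x. cnj (f (up x)) * (of_real (coeff_up q x) * g x)"
  let ?v = "\<lambda>x. cnj (f (down x)) * (of_real (coeff_down q x) * g x)"
  have s: "?u summable_on UNIV" "?v summable_on UNIV"
    by (rule summable_on_inner_shift[OF f g] bij_shift coefficient_bounds[OF q] | assumption)+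
  have s': "(\<lambda>y. ?u (up_inv y)) summable_on UNIV" "(\<lambda>y. ?v (down_inv y)) summable_on UNIV"
    using s summable_on_reindex_bij_betw[OF bij_shift(3), of ?u] summable_on_reindex_bij_betw[OF bij_shift(4), of ?v]
    by blast+
  have "inner_prod (beta_adj_coord q f) g = (\<Sum>\<^sub>\<infinity>x. ?u x + ?v x)"
    unfolding inner_prod_UNIV(1)[OF beta_adj_coord_ell2[OF q f]]
    by (rule infsum_cong) (use ell2D[OF g] in \<open>auto simp: beta_adj_coord_def algebra_simps\<close>)
  also have "\<dots> = infsum ?u UNIV + infsum ?v UNIV"
    by (rule infsum_add[OF s])
  also have "infsum ?u UNIV = (\<Sum>\<^sub>\<infinity>y. ?u (up_inv y))"
    by (rule infsum_reindex_bij_betw[OF bij_shift(3), symmetric])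
  also have "infsum ?v UNIV = (\<Sum>\<^sub>\<infinity>y. ?v (down_inv y))"
    by (rule infsum_reindex_bij_betw[OF bij_shift(4), symmetric])
  also have "(\<Sum>\<^sub>\<infinity>y. ?u (up_inv y)) + (\<Sum>\<^sub>\<infinity>y. ?v (down_inv y)) = (\<Sum>\<^sub>\<infinity>y. ?u (up_inv y) + ?v (down_inv y))"
    by (rule infsum_add[OF s', symmetric])
  also have "\<dots> = inner_prod f (beta_coord q g)"
    unfolding inner_prod_UNIV(1)[OF f] by (simp add: beta_coord_def distrib_left)
  finally show ?thesis .
qed

lemma ket_ell2: "x \<in> idx \<Longrightarrow> ket x \<in> ell2"
proof -
  assume "x \<in> idx"
  moreover have "(\<lambda>y. (cmod (ket x y))\<^sup>2) summable_on UNIV \<longleftrightarrow> (\<lambda>y. (cmod (ket x y))\<^sup>2) summable_on {x}"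
    by (rule summable_on_cong_neutral) (auto simp: ket_def)
  ultimately show ?thesis by (auto simp: ell2_iff ket_def)
qed

lemma inner_prod_ket:
  assumes "x \<in> idx"
  shows "inner_prod (ket x) g = g x" "inner_prod g (ket x) = cnj (g x)"
proof -
  have "inner_prod (ket x) g = (\<Sum>\<^sub>\<infinity>y\<in>{x}. cnj (ket x y) * g y)"
    unfolding inner_prod_def by (rule infsum_cong_neutral) (use assms in \<open>auto simp: ket_def\<close>)
  then show "inner_prod (ket x) g = g x" by (simp add: ket_def)
  have "inner_prod g (ket x) = (\<Sum>\<^sub>\<infinity>y\<in>{x}. cnj (g y) * ket x y)"
    unfolding inner_prod_def by (rule infsum_cong_neutral) (use assms in \<open>auto simp: ket_def\<close>)
  then show "inner_prod g (ket x) = cnj (g x)" by (simp add: ket_def)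
qed

text \<open>\<open>adj\<close> is a choice: \<open>beta_adj_coord q\<close> shows that a candidate
  exists, and testing against basis vectors that it is unique on \<open>ell2\<close>.\<close>

lemma adj_beta_eq:
  assumes q: "0 < q" "q < 1" and f: "f \<in> ell2"
  shows "adj (beta q) f = beta_adj_coord q f"
proof -
  let ?P = "\<lambda>S. \<forall>f\<in>ell2. S f \<in> ell2 \<and> (\<forall>g\<in>ell2. inner_prod (S f) g = inner_prod f (beta q g))"
  have "?P (beta_adj_coord q)"
    using beta_adj_coord_ell2[OF q] inner_prod_beta_adj_coord[OF q] by (simp add: beta_eq)
  then have "?P (adj (beta q))"
    unfolding adj_def by (rule someI[where P = ?P])
  then have A: "adj (beta q) f \<in> ell2" "\<And>g. g \<in> ell2 \<Longrightarrow> inner_prod (adj (beta q) f) g = inner_prod (beta_adj_coord q f) g"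
    using f inner_prod_beta_adj_coord[OF q f] by (auto simp: beta_eq)
  show ?thesis
  proof
    fix x
    show "adj (beta q) f x = beta_adj_coord q f x"
    proof (cases "x \<in> idx")
      case True
      then have "cnj (adj (beta q) f x) = cnj (beta_adj_coord q f x)"
        using A(2)[OF ket_ell2[OF True]] by (simp add: inner_prod_ket)
      then show ?thesis by simp
    next
      case False
      then show ?thesis using ell2D A(1) beta_adj_coord_ell2[OF q f] by metis
    qed
  qed
qed

subsection \<open>Normality and diagonal entries\<close>

lemma sqrt_one_minus_squared:
  assumes "0 < q" "q < (1::real)"
  shows "(sqrt (1 - q ^ (2 * m)))\<^sup>2 = 1 - (q\<^sup>2) ^ m"
  using assms by (simp add: power_le_one power_mult)

lemma coeff_up_squared:
  assumes q: "0 < q" "q < 1" and n: "2 * n = real N" "n + i = real a" "n + j = real b" "a \<le> N" "b \<le> N"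
  shows "(coeff_up q (n, i, j))\<^sup>2 = (q\<^sup>2) ^ b * (1 - (q\<^sup>2) ^ (N - b + 1)) * (1 - (q\<^sup>2) ^ (a + 1)) /
           ((1 - (q\<^sup>2) ^ (N + 1)) * (1 - (q\<^sup>2) ^ (N + 2)))"
proof -
  have e: "n + j = real b" "2 * n - 2 * j + 2 = real (2 * (N - b + 1))" "2 * n + 2 * i + 2 = real (2 * (a + 1))"
      "4 * n + 2 = real (2 * (N + 1))" "4 * n + 4 = real (2 * (N + 2))"
    using n by (auto simp: of_nat_diff)
  show ?thesis
    unfolding coeff_up_def b_plus_def prod.case e powr_realpow[OF q(1)] power_divide power_mult_distrib power2_minus
      sqrt_one_minus_squared[OF q] power_mult[of q b 2, symmetric] mult.commute[of b 2] power_mult[of q 2 b]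
    by (simp only: mult_ac)
qed

lemma coeff_down_squared:
  assumes q: "0 < q" "q < 1" and n: "2 * n = real N" "n + i = real a" "n + j = real b" "a \<le> N" "b \<le> N"
  shows "(coeff_down q (n, i, j))\<^sup>2 = (q\<^sup>2) ^ a * (1 - (q\<^sup>2) ^ b) * (1 - (q\<^sup>2) ^ (N - a)) /
           ((1 - (q\<^sup>2) ^ N) * (1 - (q\<^sup>2) ^ (N + 1)))"
proof (cases "N = 0")
  case True
  then show ?thesis using n by (simp add: coeff_down_def b_minus_def)
next
  case False
  then have "n \<noteq> 0" using n by auto
  have e: "n + i = real a" "2 * n + 2 * j = real (2 * b)" "2 * n - 2 * i = real (2 * (N - a))"
      "4 * n = real (2 * N)" "real (2 * N) + 2 = real (2 * (N + 1))"
    using n by (auto simp: of_nat_diff)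
  show ?thesis
    unfolding coeff_down_def b_minus_def prod.case if_not_P[OF \<open>n \<noteq> 0\<close>] e powr_realpow[OF q(1)] power_divide power_mult_distrib
      sqrt_one_minus_squared[OF q] power_mult[of q a 2, symmetric] mult.commute[of a 2] power_mult[of q 2 a]
    by (simp only: mult_ac)
qed

text \<open>With v p = u r = w the terms pair off by denominators: \<open>up_inv\<close> minus
  \<open>down\<close> and \<open>up\<close> minus \<open>down_inv\<close> both give
  \<open>(v - u) / (1 - X * w)\<close>.\<close>

lemma normality_diagonal:
  assumes q: "0 < q" "q < 1" and "x \<in> idx"
  shows "(coeff_up q (up_inv x))\<^sup>2 + (coeff_down q (down_inv x))\<^sup>2 = (coeff_up q x)\<^sup>2 + (coeff_down q x)\<^sup>2"
proof -
  obtain n i j where x: "x = (n, i, j)" "(n, i, j) \<in> idx" using assms by (cases x) auto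
  obtain N a b where n: "2 * n = real N" "n + i = real a" "n + j = real b" "a \<le> N" "b \<le> N"
    using x(2) by (rule idxE)
  define X where "X = q\<^sup>2"
  define u v w p r where "u = X ^ a" and "v = X ^ b" and "w = X ^ N" and "p = X ^ (N - b)" and "r = X ^ (N - a)"
  have vp: "v * p = w" and ur: "u * r = w"
    using n by (simp_all add: u_def v_def w_def p_def r_def power_add[symmetric])
  have X: "0 < X" "X < 1"
    using q by (auto simp: X_def power_less_one_iff)
  have 1: "(coeff_up q x)\<^sup>2 = v * (1 - X * p) * (1 - X * u) / ((1 - X * w) * (1 - X\<^sup>2 * w))"
    unfolding x(1) coeff_up_squared[OF q n] X_def[symmetric]
    by (simp add: u_def v_def w_def p_def power2_eq_square mult_ac)
  have 2: "(coeff_down q x)\<^sup>2 = u * (1 - v) * (1 - r) / ((1 - w) * (1 - X * w))"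
    unfolding x(1) coeff_down_squared[OF q n] X_def[symmetric]
    by (simp add: u_def v_def w_def r_def)
  have "(coeff_down q (n + 1/2, i - 1/2, j + 1/2))\<^sup>2 = u * (1 - X * v) * (1 - X * r) / ((1 - X * w) * (1 - X\<^sup>2 * w))"
    by (subst coeff_down_squared[OF q, of _ "Suc N" _ a _ "Suc b"])
      (use n in \<open>auto simp: X_def[symmetric] u_def v_def w_def r_def power2_eq_square[of X] Suc_diff_le mult_ac\<close>)
  then have 3: "(coeff_down q (down_inv x))\<^sup>2 = u * (1 - X * v) * (1 - X * r) / ((1 - X * w) * (1 - X\<^sup>2 * w))"
    by (simp add: x(1) down_inv_def)
  have 4: "(coeff_up q (up_inv x))\<^sup>2 = v * (1 - p) * (1 - u) / ((1 - w) * (1 - X * w))"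
  proof (cases "up_inv x \<in> idx")
    case True
    then obtain N' a' b' where n': "2 * (n - 1/2) = real N'" "(n - 1/2) + (i - 1/2) = real a'"
        "(n - 1/2) + (j + 1/2) = real b'" "a' \<le> N'" "b' \<le> N'"
      unfolding x(1) up_inv_def prod.case by (rule idxE)
    have "real N = real N' + 1" "real a = real a' + 1" "real b = real b'"
      using n(1-3) n'(1-3) by (simp_all add: field_simps)
    then have eq: "N = Suc N'" "a = Suc a'" "b = b'"
      by linarith+
    show ?thesis
      unfolding x(1) up_inv_def prod.case coeff_up_squared[OF q n'] X_def[symmetric]
      using n' by (simp add: eq u_def v_def w_def p_def Suc_diff_le)
  next
    case False
    \<comment> \<open>Outside \<open>idx\<close> the coefficient vanishes, and so does the formula,
      since p = 1 or u = 1.\<close>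
    have "b = N \<or> a = 0"
    proof (rule ccontr)
      assume "\<not> ?thesis"
      then have "up_inv x \<in> idx"
        unfolding x up_inv_def using n
        by (auto intro!: idxI[of _ "N - 1" _ "a - 1" _ b] simp: of_nat_diff)
      then show False using False by blast
    qed
    then have "p = 1 \<or> u = 1" by (auto simp: p_def u_def)
    then show ?thesis
      using coeff_up_up_inv_eq_0[OF q(1) assms(3) False] by auto
  qed
  show ?thesis
  \<comment> \<open>At N = 0 the denominator 1 - w is 0, so the values are compared
    directly.\<close>
  proof (cases "N = 0")
    case True
    then have "u = 1" "v = 1" "w = 1" "p = 1" "r = 1"
      using n by (auto simp: u_def v_def w_def p_def r_def)
    then show ?thesis unfolding 1 2 3 4 by simp
  next
    case False
    have "X ^ m \<noteq> 1" if "m \<noteq> 0" for m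
      using power_Suc_less_one[OF X] that by (cases m) (auto simp: less_le)
    from this[of N] this[of "Suc N"] this[of "Suc (Suc N)"]
    have nz: "1 - w \<noteq> 0" "1 - X * w \<noteq> 0" "1 - X\<^sup>2 * w \<noteq> 0"
      using False by (auto simp: w_def power2_eq_square mult_ac)
    have "v * (1 - p) = v - w" "v * (1 - X * p) = v - X * w" "u * (1 - r) = u - w" "u * (1 - X * r) = u - X * w"
      using vp ur by (auto simp: algebra_simps)
    then have e: "v * (1 - p) * (1 - u) = (v - w) * (1 - u)" "v * (1 - X * p) * (1 - X * u) = (v - X * w) * (1 - X * u)"
       "u * (1 - v) * (1 - r) = (u - w) * (1 - v)" "u * (1 - X * v) * (1 - X * r) = (u - X * w) * (1 - X * v)"
      by (auto simp: mult_ac)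
    have lin: "a - b = e \<Longrightarrow> c - d = e \<Longrightarrow> a + d = c + b" for a b c d e :: real
      by linarith
    have "(v - w) * (1 - u) / ((1 - w) * (1 - X * w)) - (u - w) * (1 - v) / ((1 - w) * (1 - X * w)) = (v - u) / (1 - X * w)"
      using nz by (simp add: divide_simps) (simp add: algebra_simps)
    moreover have "(v - X * w) * (1 - X * u) / ((1 - X * w) * (1 - X\<^sup>2 * w)) - (u - X * w) * (1 - X * v) / ((1 - X * w) * (1 - X\<^sup>2 * w)) = (v - u) / (1 - X * w)"
      using nz by (simp add: divide_simps) (simp add: algebra_simps power2_eq_square)
    ultimately show ?thesis unfolding 1 2 3 4 e by (rule lin)
  qed
qed

text \<open>These are the entries between (n, i, j) and (n + 1, i, j). The same square roots occur
  on both sides, with the same total power of q.\<close>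

lemma normality_off_diagonal:
  assumes q: "0 < q" and "x \<in> idx"
  shows "coeff_down q (down_inv x) * coeff_up q (down_inv x) = coeff_up q x * coeff_down q (down_inv (up x))"
proof -
  obtain n i j where x: "x = (n, i, j)" "(n, i, j) \<in> idx" using assms by (cases x) auto
  obtain N a b where n: "2 * n = real N" "n + i = real a" "n + j = real b" "a \<le> N" "b \<le> N"
    using x(2) by (rule idxE)
  have "n \<ge> 0" using n by simp
  then have nz: "n + 1/2 \<noteq> 0" "n + 1/2 + 1/2 \<noteq> 0" by linarith+
  have 1: "n + 1/2 + (i - 1/2) = n + i" "2 * (n + 1/2) + 2 * (j + 1/2) = 2 * n + 2 * j + 2"
     "2 * (n + 1/2) - 2 * (i - 1/2) = 2 * n - 2 * i + 2" "4 * (n + 1/2) + 2 = 4 * n + 4" "4 * (n + 1/2) = 4 * n + 2"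
     "n + 1/2 + (j + 1/2) = n + j + 1" "2 * (n + 1/2) - 2 * (j + 1/2) + 2 = 2 * n - 2 * j + 2"
     "2 * (n + 1/2) + 2 * (i - 1/2) + 2 = 2 * n + 2 * i + 2" "4 * (n + 1/2) + 4 = 4 * n + 6"
    by (simp_all add: algebra_simps)
  have 2: "n + 1/2 + 1/2 + (i + 1/2 - 1/2) = n + i + 1" "2 * (n + 1/2 + 1/2) + 2 * (j - 1/2 + 1/2) = 2 * n + 2 * j + 2"
     "2 * (n + 1/2 + 1/2) - 2 * (i + 1/2 - 1/2) = 2 * n - 2 * i + 2"
     "4 * (n + 1/2 + 1/2) + 2 = 4 * n + 6" "4 * (n + 1/2 + 1/2) = 4 * n + 4"
    by (simp_all add: algebra_simps)
  show ?thesis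
    unfolding x(1) coeff_down_def coeff_up_def down_inv_def up_def prod.case b_minus_def b_plus_def if_not_P[OF nz(1)] if_not_P[OF nz(2)] 1 2
    by (simp add: powr_add mult_ac)
qed

lemma beta_coord_adj_commute:
  assumes q: "0 < q" "q < 1" and f: "f \<in> ell2"
  shows "beta_coord q (beta_adj_coord q f) = beta_adj_coord q (beta_coord q f)"
proof
  fix x
  show "beta_coord q (beta_adj_coord q f) x = beta_adj_coord q (beta_coord q f) x"
  proof (cases "x \<in> idx")
    case False
    then show ?thesis using ell2D beta_coord_ell2[OF q] beta_adj_coord_ell2[OF q] f by metis
  next
    case True
    have comm: "down_inv (up x) = up (down_inv x)" "up_inv (down x) = down (up_inv x)"
      by (auto simp: shift_defs split: prod.splits)
    have 1: "of_real (coeff_up q (up_inv x)) * beta_adj_coord q f (up_inv x) =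
        of_real (coeff_up q (up_inv x)) * (of_real (coeff_up q (up_inv x)) * f x + of_real (coeff_down q (up_inv x)) * f (down (up_inv x)))"
      using coeff_up_up_inv_eq_0[OF q(1) True] by (cases "up_inv x \<in> idx") (auto simp: beta_adj_coord_def)
    have 2: "beta_adj_coord q f (down_inv x) = of_real (coeff_up q (down_inv x)) * f (up (down_inv x)) + of_real (coeff_down q (down_inv x)) * f x"
      using down_inv_idx[OF True] by (simp add: beta_adj_coord_def)
    have 3: "beta_adj_coord q (beta_coord q f) x = of_real (coeff_up q x) * (of_real (coeff_up q x) * f x + of_real (coeff_down q (down_inv (up x))) * f (up (down_inv x)))
        + of_real (coeff_down q x) * (of_real (coeff_up q (down (up_inv x))) * f (down (up_inv x)) + of_real (coeff_down q x) * f x)"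
      using True by (simp add: beta_adj_coord_def beta_coord_def comm)
    have hi: "complex_of_real (coeff_down q (down_inv x)) * of_real (coeff_up q (down_inv x)) = of_real (coeff_up q x) * of_real (coeff_down q (down_inv (up x)))"
      unfolding of_real_mult[symmetric] normality_off_diagonal[OF q(1) True] ..
    \<comment> \<open>The entry towards (n - 1, i, j) is the off-diagonal identity taken at that
      index; if it is not in \<open>idx\<close>, f vanishes there.\<close>
    have lo: "of_real (coeff_up q (up_inv x)) * of_real (coeff_down q (up_inv x)) * f (down (up_inv x)) =
        of_real (coeff_down q x) * of_real (coeff_up q (down (up_inv x))) * f (down (up_inv x))"
    proof (cases "down (up_inv x) \<in> idx")
      case True
      have "down_inv (up (down (up_inv x))) = x"
        by (auto simp: shift_defs split: prod.splits)
      then show ?thesis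
        using normality_off_diagonal[OF q(1) True]
        by (simp only: shift_inverse of_real_mult[symmetric] mult.commute[of "coeff_up q _" "coeff_down q _"])
    qed (simp add: ell2D[OF f])
    have diag: "(complex_of_real (coeff_up q (up_inv x)))\<^sup>2 + (of_real (coeff_down q (down_inv x)))\<^sup>2 = (of_real (coeff_up q x))\<^sup>2 + (of_real (coeff_down q x))\<^sup>2"
      unfolding of_real_power[symmetric] of_real_add[symmetric] normality_diagonal[OF q True] ..
    have "beta_coord q (beta_adj_coord q f) x =
        ((of_real (coeff_up q (up_inv x)))\<^sup>2 + (of_real (coeff_down q (down_inv x)))\<^sup>2) * f x
        + of_real (coeff_up q (up_inv x)) * of_real (coeff_down q (up_inv x)) * f (down (up_inv x))
        + of_real (coeff_down q (down_inv x)) * of_real (coeff_up q (down_inv x)) * f (up (down_inv x))"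
      unfolding beta_coord_def 1 2 by (simp add: algebra_simps power2_eq_square)
    also have "\<dots> = beta_adj_coord q (beta_coord q f) x"
      unfolding diag lo hi 3 by (simp add: algebra_simps power2_eq_square)
    finally show ?thesis .
  qed
qed

section \<open>Powers of the squared modulus and their entries on the range of
  \<open>P\<close>\<close>

definition modulus_sq :: "real \<Rightarrow> vec \<Rightarrow> vec" where
  "modulus_sq q f = beta_adj_coord q (beta_coord q f)"

text \<open>The index of the \<open>k\<close>-th vector of level \<open>N = 2n\<close> in the range of \<open>P\<close>, that is \<open>i = n\<close> and \<open>k = n + j\<close>.\<close>

definition tip :: "nat \<times> nat \<Rightarrow> index" where
  "tip = (\<lambda>(N, k). (real N / 2, real N / 2, real k - real N / 2))"

lemma tip_idx: "k \<le> N \<Longrightarrow> tip (N, k) \<in> idx"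
  unfolding tip_def by (auto intro!: idxI[of _ N _ N _ k])

lemma up_tip: "up (tip (N, k)) = tip (Suc N, k)"
  by (simp add: up_def tip_def add_divide_distrib)

lemma idx_top_imp_tip:
  assumes "x \<in> idx" "fst (snd x) = fst x"
  shows "x \<in> tip ` (SIGMA N:UNIV. {..N})"
proof -
  obtain n i j where x: "x = (n, i, j)" "(n, i, j) \<in> idx" using assms by (cases x) auto
  obtain N a b where n: "2 * n = real N" "n + i = real a" "n + j = real b" "a \<le> N" "b \<le> N"
    using x(2) by (rule idxE)
  have "x = tip (N, b)"
    using n assms(2) by (auto simp: x tip_def)
  then show ?thesis using n by auto
qed

lemma inj_tip: "inj tip"
  by (auto simp: inj_def tip_def)

context
  fixes q :: real
  assumes q: "0 < q" "q < 1"
begin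

lemma modulus_sq_ell2: "f \<in> ell2 \<Longrightarrow> (modulus_sq q ^^ r) f \<in> ell2"
proof (induction r)
  case (Suc r)
  then show ?case
    by (simp add: modulus_sq_def[of q "(modulus_sq q ^^ r) f"] beta_coord_ell2[OF q] beta_adj_coord_ell2[OF q])
qed simp

lemma adj_beta_beta_pow:
  "f \<in> ell2 \<Longrightarrow> ((adj (beta q) \<circ> beta q) ^^ r) f = (modulus_sq q ^^ r) f"
proof (induction r)
  case (Suc r)
  let ?g = "(modulus_sq q ^^ r) f"
  have "(adj (beta q) \<circ> beta q) ?g = modulus_sq q ?g"
    using modulus_sq_ell2[OF Suc.prems, of r]
    by (simp add: beta_eq adj_beta_eq[OF q] beta_coord_ell2[OF q] modulus_sq_def[of q ?g])
  with Suc show ?case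
    by (simp only: funpow.simps comp_apply)
qed simp

lemma modulus_sq_scale: "(modulus_sq q ^^ r) (\<lambda>y. c * f y) = (\<lambda>y. c * (modulus_sq q ^^ r) f y)"
proof (induction r)
  case (Suc r)
  have "modulus_sq q (\<lambda>y. c * g y) = (\<lambda>y. c * modulus_sq q g y)" for g
    by (auto simp: modulus_sq_def beta_adj_coord_def beta_coord_def algebra_simps)
  then show ?case using Suc by simp
qed simp

lemma beta_coord_modulus_sq_commute:
  "f \<in> ell2 \<Longrightarrow> beta_coord q ((modulus_sq q ^^ r) f) = (modulus_sq q ^^ r) (beta_coord q f)"
proof (induction r)
  case (Suc r)
  let ?g = "(modulus_sq q ^^ r) f"
  have "?g \<in> ell2" by (rule modulus_sq_ell2[OF Suc.prems])
  then have "beta_coord q (modulus_sq q ?g) = modulus_sq q (beta_coord q ?g)"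
    by (simp add: modulus_sq_def[of q ?g] modulus_sq_def[of q "beta_coord q ?g"] beta_coord_adj_commute[OF q] beta_coord_ell2[OF q])
  then show ?case using Suc by simp
qed simp

text \<open>A square root vanishes at i = n. Hence \<beta> maps \<open>tip (N, k)\<close> to a
  multiple of \<open>tip (Suc N, k)\<close>.\<close>

lemma coeff_down_tip: "coeff_down q (tip (N, k)) = 0"
  using q by (simp add: coeff_down_def tip_def b_minus_def)

lemma coeff_up_tip_squared:
  assumes "k \<le> N"
  shows "(coeff_up q (tip (N, k)))\<^sup>2 = (q\<^sup>2) ^ k * (1 - (q\<^sup>2) ^ (N - k + 1)) / (1 - (q\<^sup>2) ^ (N + 2))"
proof -
  have "(q\<^sup>2) ^ (N + 1) < 1"
    using q by (simp only: power_mult[symmetric]) (auto simp: power_less_one_iff simp del: power_Suc)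
  then show ?thesis
    unfolding tip_def prod.case
    by (subst coeff_up_squared[OF q, of _ N _ N _ k]) (use assms in \<open>auto simp: divide_simps simp del: power_Suc\<close>)
qed

text \<open>Iterated, this exhibits \<open>level_entry\<close> as the product of the squared weights
  at (N, k), (N + 1, k), ..., (N + r - 1, k).\<close>

lemma coeff_up_tip_level_entry:
  assumes "k \<le> N"
  shows "(coeff_up q (tip (N, k)))\<^sup>2 * level_entry (q\<^sup>2) r (Suc N) k = level_entry (q\<^sup>2) (Suc r) N k"
proof -
  define X where "X = q\<^sup>2"
  have "qprod X (Suc r) (N - k + 1) = (1 - X ^ (N - k + 1)) * qprod X r (Suc N - k + 1)"
    using qprod_Suc'[of X r "N - k + 1"] assms by (simp add: Suc_diff_le)
  moreover have "qprod X (Suc r) (N + 2) = (1 - X ^ (N + 2)) * qprod X r (Suc N + 2)"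
    by (simp only: qprod_Suc' add_Suc)
  moreover have "X ^ (Suc r * k) = X ^ k * X ^ (r * k)"
    by (simp add: power_add)
  ultimately show ?thesis
    unfolding coeff_up_tip_squared[OF assms] level_entry_def X_def[symmetric]
    by (simp only: times_divide_times_eq mult_ac)
qed

lemma modulus_sq_pow_entry:
  assumes "k \<le> N"
  shows "(modulus_sq q ^^ r) (ket (tip (N, k))) (tip (N, k)) = of_real (level_entry (q\<^sup>2) r N k)"
  using assms
proof (induction r arbitrary: N)
  case 0
  have "qprod (q\<^sup>2) 0 m = 1" for m by (simp add: qprod_def)
  then show ?case by (simp add: ket_def level_entry_def)
next
  case (Suc r)
  let ?x = "tip (N, k)"
  have x: "?x \<in> idx" by (rule tip_idx[OF Suc.prems])
  have ket: "beta_coord q (ket ?x) = (\<lambda>y. of_real (coeff_up q ?x) * ket (up ?x) y)"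
  proof
    fix y
    have "up_inv y = ?x \<longleftrightarrow> y = up ?x"
      by (metis shift_inverse(1,2))
    then show "beta_coord q (ket ?x) y = of_real (coeff_up q ?x) * ket (up ?x) y"
      using coeff_down_tip by (auto simp: beta_coord_def ket_def)
  qed
  have "(modulus_sq q ^^ Suc r) (ket ?x) ?x = of_real (coeff_up q ?x) * beta_coord q ((modulus_sq q ^^ r) (ket ?x)) (up ?x)"
    using x by (simp add: modulus_sq_def beta_adj_coord_def coeff_down_tip)
  \<comment> \<open>Normality enters here: \<beta> moves through the power onto the basis
    vector.\<close>
  also have "\<dots> = of_real (coeff_up q ?x) * (modulus_sq q ^^ r) (beta_coord q (ket ?x)) (up ?x)"
    by (simp only: beta_coord_modulus_sq_commute[OF ket_ell2[OF x]])
  also have "\<dots> = of_real ((coeff_up q ?x)\<^sup>2) * (modulus_sq q ^^ r) (ket (tip (Suc N, k))) (tip (Suc N, k))"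
    by (simp add: ket modulus_sq_scale up_tip power2_eq_square)
  also have "\<dots> = of_real ((coeff_up q ?x)\<^sup>2 * level_entry (q\<^sup>2) r (Suc N) k)"
    using Suc.IH[of "Suc N"] Suc.prems by simp
  also have "(coeff_up q ?x)\<^sup>2 * level_entry (q\<^sup>2) r (Suc N) k = level_entry (q\<^sup>2) (Suc r) N k"
    by (rule coeff_up_tip_level_entry[OF Suc.prems])
  finally show ?case .
qed

end

subsection \<open>The trace\<close>

lemma P_scale_ket:
  assumes "x \<in> idx"
  shows "P (\<lambda>y. a * ket x y) = (\<lambda>y. (if fst (snd x) = fst x then a else 0) * ket x y)"
proof -
  have "extend_op v (\<lambda>y. a * ket x y) = (\<lambda>y. a * extend_op v (ket x) y)" for v
    by (simp add: extend_op_def mult.assoc infsum_cmult_right')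
  then show ?thesis
    using assms by (auto simp: P_def extend_op_ket split: prod.splits)
qed

lemma absD_eig_tip: "absD_eig c (tip (N, k)) = (if N = 0 then c else real N)"
  by (simp add: absD_eig_def D_eig_def tip_def)

lemma trace_entry:
  assumes q: "0 < q" "q < 1" and x: "x \<in> idx"
  shows "inner_prod (ket x) ((((adj (beta q) \<circ> beta q) ^^ r) \<circ> P \<circ> absD_power c z) (ket x)) =
    (if fst (snd x) = fst x then of_real (absD_eig c x) powr z else 0) * (modulus_sq q ^^ r) (ket x) x"
proof -
  let ?a = "if fst (snd x) = fst x then of_real (absD_eig c x) powr z else 0 :: complex"
  have "P (absD_power c z (ket x)) = (\<lambda>y. ?a * ket x y)"
    unfolding absD_power_def extend_op_ket[OF x] by (rule P_scale_ket[OF x])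
  moreover have "(\<lambda>y. ?a * ket x y) \<in> ell2"
    using ket_ell2[OF x] by (auto simp: ell2_iff norm_mult power_mult_distrib intro!: summable_on_cmult_right)
  ultimately show ?thesis
    by (simp only: comp_apply inner_prod_ket[OF x] adj_beta_beta_pow[OF q] modulus_sq_scale[OF q])
qed

text \<open>The trace runs over vectors, the Dirichlet series over levels. Entries are nonnegative,
  so the norms within a level add up to the norm of its term, and absolute summability passes from
  levels to vectors.\<close>

lemma has_trace_modulus:
  assumes q: "0 < q" "q < 1" 
    and sm: "summable (\<lambda>N. norm (weight c s N * of_real (level_trace (q\<^sup>2) r N)))"
    and g: "(\<lambda>N. weight c s N * of_real (level_trace (q\<^sup>2) r N)) sums g"
  shows "has_trace (((adj (beta q) \<circ> beta q) ^^ r) \<circ> P \<circ> absD_power c (- s)) g"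
proof -
  let ?S = "SIGMA N:UNIV. {..N::nat}"
  let ?f = "\<lambda>x. inner_prod (ket x) ((((adj (beta q) \<circ> beta q) ^^ r) \<circ> P \<circ> absD_power c (- s)) (ket x))"
  let ?h = "\<lambda>(N, k). weight c s N * of_real (level_entry (q\<^sup>2) r N k)"
  have X: "0 < q\<^sup>2" "q\<^sup>2 < 1"
    using q by (auto simp: power_less_one_iff)
  have "(?h has_sum g) ?S"
  proof (rule has_sum_SigmaI)
    show "((\<lambda>k. ?h (N, k)) has_sum (weight c s N * of_real (level_trace (q\<^sup>2) r N))) {..N}" for N
      by (rule has_sum_finiteI) (auto simp: level_trace_def sum_distrib_left)
    show "((\<lambda>N. weight c s N * of_real (level_trace (q\<^sup>2) r N)) has_sum g) UNIV"
      by (rule norm_summable_imp_has_sum[OF sm g])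
    have "(\<lambda>p. norm (?h p)) summable_on ?S"
    proof (rule summable_on_SigmaI)
      show "((\<lambda>k. norm (?h (N, k))) has_sum norm (weight c s N * of_real (level_trace (q\<^sup>2) r N))) {..N}" for N
      proof (rule has_sum_finiteI)
        have "norm (weight c s N * of_real (level_trace (q\<^sup>2) r N)) = norm (weight c s N) * level_trace (q\<^sup>2) r N"
          using level_trace_bounds(1)[OF X, of r N] by (simp add: norm_mult)
        also have "\<dots> = (\<Sum>k\<le>N. norm (weight c s N) * level_entry (q\<^sup>2) r N k)"
          by (simp add: level_trace_def sum_distrib_left)
        also have "\<dots> = (\<Sum>k\<le>N. norm (?h (N, k)))"
          using level_entry_bounds(1)[OF X, of _ N r] by (intro sum.cong) (auto simp: norm_mult)
        finally show "norm (weight c s N * of_real (level_trace (q\<^sup>2) r N)) = (\<Sum>k\<le>N. norm (?h (N, k)))" .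
      qed auto
      show "(\<lambda>N. norm (weight c s N * of_real (level_trace (q\<^sup>2) r N))) summable_on UNIV"
        by (rule norm_summable_imp_summable_on) (use sm in simp)
    qed auto
    then show "?h summable_on ?S"
      by (rule abs_summable_summable)
  qed
  moreover have "?f (tip p) = ?h p" if pS: "p \<in> ?S" for p
  proof -
    obtain N k where p: "p = (N, k)" "k \<le> N" using pS by (cases p) auto
    have "?f (tip (N, k)) = of_real (absD_eig c (tip (N, k))) powr (- s) * (modulus_sq q ^^ r) (ket (tip (N, k))) (tip (N, k))"
      unfolding trace_entry[OF q tip_idx[OF p(2)]] by (simp add: tip_def)
    then show ?thesis
      unfolding p modulus_sq_pow_entry[OF q p(2)] absD_eig_tip by (simp add: weight_def)
  qed
  ultimately have "((?f \<circ> tip) has_sum g) ?S"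
    by (subst has_sum_cong[of _ _ ?h]) auto
  then have "(?f has_sum g) (tip ` ?S)"
    by (subst has_sum_reindex) (auto intro: inj_on_subset[OF inj_tip])
  moreover have "(?f has_sum g) (tip ` ?S) \<longleftrightarrow> (?f has_sum g) idx"
  proof (rule has_sum_cong_neutral)
    fix x assume "x \<in> idx - tip ` ?S"
    then have x: "x \<in> idx" "fst (snd x) \<noteq> fst x"
      using idx_top_imp_tip[of x] by auto
    show "?f x = 0"
      unfolding trace_entry[OF q x(1)] using x(2) by simp
  qed (auto simp: tip_idx)
  ultimately show ?thesis
    by (simp add: has_trace_def)
qed

lemma psi0_eqI:
  assumes "trace_value_at_0 (\<lambda>s. a \<circ> P \<circ> absD_power c (- s)) v"
  shows "psi0 c a = 2 * v"
  unfolding psi0_def using assms trace_value_at_0_unique by (metis (no_types, lifting) the_equality)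

lemma psi0_modulus:
  assumes q: "0 < q" "q < 1" and c: "0 < c"
  shows "psi0 c ((adj (beta q) \<circ> beta q) ^^ Suc r) =
    2 * of_real ((\<Sum>N. level_dev (q\<^sup>2) (Suc r) N) + 1 / (1 - (q\<^sup>2) ^ Suc r) / 2)"
proof -
  let ?a = "level_trace (q\<^sup>2) (Suc r)" and ?C = "1 / (1 - (q\<^sup>2) ^ Suc r)"
  have X: "0 < q\<^sup>2" "q\<^sup>2 < 1"
    using q by (auto simp: power_less_one_iff)
  have "summable (\<lambda>N. real (Suc N) * \<bar>?a N - ?C\<bar>)"
    using summable_level_dev[OF X, of r] by (simp only: level_dev_def)
  from dirichlet_continuation[OF c this] obtain g where g: "g meromorphic_on {s. Re s > - (1/2)}" "g analytic_on {0}"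
    "g 0 = of_real ((\<Sum>n. ?a n - ?C) + ?C / 2)"
    "\<forall>s. Re s > 1 \<longrightarrow> summable (\<lambda>n. norm (weight c s n * of_real (?a n))) \<and>
       (\<lambda>n. weight c s n * of_real (?a n)) sums g s"
    by blast
  have "has_trace (((adj (beta q) \<circ> beta q) ^^ Suc r) \<circ> P \<circ> absD_power c (- s)) (g s)" if "Re s > 1" for s
    by (rule has_trace_modulus[OF q]) (use g(4) that in blast)+
  then have "trace_value_at_0 (\<lambda>s. ((adj (beta q) \<circ> beta q) ^^ Suc r) \<circ> P \<circ> absD_power c (- s)) (g 0)"
    unfolding trace_value_at_0_def using g(1,2) by (intro exI[of _ g] exI[of _ "- (1/2)"] exI[of _ 1]) auto
  then show ?thesis
    unfolding level_dev_def by (subst psi0_eqI) (simp_all only: g(3))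
qed

subsection \<open>Fractions with poles at roots of unity\<close>

text \<open>Poles are tested over the complex numbers, values only on ]0,1[. As 0 is no root of
  unity, the condition on zeros excludes B = 0.\<close>

definition cyclotomic_fraction :: "(real \<Rightarrow> real) \<Rightarrow> bool" where
  "cyclotomic_fraction f \<longleftrightarrow> (\<exists>A B :: complex poly. (\<forall>z. poly B z = 0 \<longrightarrow> (\<exists>k::nat. k \<ge> 1 \<and> z ^ k = 1)) \<and>
     (\<forall>x. 0 < x \<and> x < 1 \<longrightarrow> of_real (f x) = poly A (of_real x) / poly B (of_real x)))"

lemma not_root_of_unity:
  assumes "0 < x" "x < (1::real)" "k \<ge> (1::nat)"
  shows "complex_of_real x ^ k \<noteq> 1"
proof -
  have "x ^ k < 1" using assms by (simp add: power_less_one_iff)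
  then show ?thesis by (metis less_irrefl of_real_eq_1_iff of_real_power)
qed

lemma cyclotomic_fraction_poly:
  assumes "\<And>x. complex_of_real (f x) = poly A (of_real x)"
  shows "cyclotomic_fraction f"
  unfolding cyclotomic_fraction_def by (rule exI[of _ A], rule exI[of _ 1]) (simp add: assms)

lemma cyclotomic_fraction_const: "cyclotomic_fraction (\<lambda>x. a)"
  by (rule cyclotomic_fraction_poly[of _ "[:of_real a:]"]) simp

lemma cyclotomic_fraction_power: "cyclotomic_fraction (\<lambda>x. x ^ m)"
  by (rule cyclotomic_fraction_poly[of _ "monom 1 m"]) (simp add: poly_monom)

lemma cyclotomic_fraction_inverse: 
  assumes "m \<ge> 1"
  shows "cyclotomic_fraction (\<lambda>x. inverse (1 - x ^ m))"
  unfolding cyclotomic_fraction_def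
  by (rule exI[of _ 1], rule exI[of _ "1 - monom 1 m"]) (use assms in \<open>auto simp: poly_monom divide_inverse\<close>)

lemma cyclotomic_fraction_mult:
  assumes "cyclotomic_fraction f" "cyclotomic_fraction g"
  shows "cyclotomic_fraction (\<lambda>x. f x * g x)"
proof -
  from assms obtain A B A' B' where
    "\<forall>z. poly B z = 0 \<longrightarrow> (\<exists>k::nat. k \<ge> 1 \<and> z ^ k = 1)" "\<forall>x. 0 < x \<and> x < 1 \<longrightarrow> complex_of_real (f x) = poly A (of_real x) / poly B (of_real x)"
    "\<forall>z. poly B' z = 0 \<longrightarrow> (\<exists>k::nat. k \<ge> 1 \<and> z ^ k = 1)" "\<forall>x. 0 < x \<and> x < 1 \<longrightarrow> complex_of_real (g x) = poly A' (of_real x) / poly B' (of_real x)"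
    unfolding cyclotomic_fraction_def by blast
  then show ?thesis
    unfolding cyclotomic_fraction_def by (intro exI[of _ "A * A'"] exI[of _ "B * B'"]) auto
qed

lemma cyclotomic_fraction_add:
  assumes "cyclotomic_fraction f" "cyclotomic_fraction g"
  shows "cyclotomic_fraction (\<lambda>x. f x + g x)"
proof -
  from assms obtain A B A' B' where *:
    "\<forall>z. poly B z = 0 \<longrightarrow> (\<exists>k::nat. k \<ge> 1 \<and> z ^ k = 1)" "\<forall>x. 0 < x \<and> x < 1 \<longrightarrow> complex_of_real (f x) = poly A (of_real x) / poly B (of_real x)"
    "\<forall>z. poly B' z = 0 \<longrightarrow> (\<exists>k::nat. k \<ge> 1 \<and> z ^ k = 1)" "\<forall>x. 0 < x \<and> x < 1 \<longrightarrow> complex_of_real (g x) = poly A' (of_real x) / poly B' (of_real x)"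
    unfolding cyclotomic_fraction_def by blast
  have "poly B (of_real x) \<noteq> 0 \<and> poly B' (of_real x) \<noteq> 0" if "0 < x" "x < 1" for x
    using not_root_of_unity[OF that] *(1,3) by blast
  then show ?thesis
    unfolding cyclotomic_fraction_def using *
    by (intro exI[of _ "A * B' + A' * B"] exI[of _ "B * B'"]) (auto simp: add_frac_eq)
qed

text \<open>Over a field a common factor that is no unit has positive degree, so cancelling it
  lowers \<open>degree B\<close>.\<close>

lemma poly_coprime_parts:
  fixes A B :: "'a :: field poly"
  assumes "B \<noteq> 0"
  shows "\<exists>A' B' F. A = A' * F \<and> B = B' * F \<and> coprime A' B'"
  using assms
proof (induction "degree B" arbitrary: A B rule: less_induct)
  case less
  show ?case
  proof (cases "coprime A B")
    case True
    then show ?thesis by (intro exI[of _ A] exI[of _ B] exI[of _ 1]) simp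
  next
    case False
    then obtain c where c: "c dvd A" "c dvd B" "\<not> is_unit c"
      by (auto simp: coprime_def)
    then obtain A1 B1 where *: "A = c * A1" "B = c * B1"
      by (auto elim!: dvdE)
    have nz: "c \<noteq> 0" "B1 \<noteq> 0" using less.prems * by auto
    then have "degree B1 < degree B"
      using c(3) by (simp add: * degree_mult_eq is_unit_iff_degree)
    from less.hyps[OF this nz(2), of A1] obtain A' B' F where "A1 = A' * F" "B1 = B' * F" "coprime A' B'"
      by blast
    then show ?thesis
      by (intro exI[of _ A'] exI[of _ B'] exI[of _ "c * F"]) (simp add: * mult_ac)
  qed
qed

text \<open>In lowest terms every zero of B is a genuine pole, so the condition on zeros speaks
  about poles.\<close>

lemma cyclotomic_fraction_coprime:
  assumes "cyclotomic_fraction f"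
  shows "\<exists>A B :: complex poly. coprime A B \<and> (\<forall>z. poly B z = 0 \<longrightarrow> (\<exists>k::nat. k \<ge> 1 \<and> z ^ k = 1)) \<and>
    (\<forall>x. 0 < x \<and> x < 1 \<longrightarrow> of_real (f x) = poly A (of_real x) / poly B (of_real x))"
proof -
  from assms obtain A B :: "complex poly" where
    AB: "\<forall>z. poly B z = 0 \<longrightarrow> (\<exists>k::nat. k \<ge> 1 \<and> z ^ k = 1)" "\<forall>x. 0 < x \<and> x < 1 \<longrightarrow> complex_of_real (f x) = poly A (of_real x) / poly B (of_real x)"
    unfolding cyclotomic_fraction_def by blast
  have "poly B 0 \<noteq> 0"
    using AB(1) by (auto simp: power_0_left)
  then have "B \<noteq> 0" by auto
  then obtain A' B' F where *: "A = A' * F" "B = B' * F" "coprime A' B'"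
    using poly_coprime_parts by blast
  have "\<exists>k::nat. k \<ge> 1 \<and> z ^ k = 1" if "poly B' z = 0" for z
    using AB(1) *(2) that by (metis mult_zero_left poly_mult)
  moreover have "of_real (f x) = poly A' (of_real x) / poly B' (of_real x)" if x: "0 < x" "x < 1" for x
  proof -
    have "poly B (of_real x) \<noteq> 0"
      using not_root_of_unity[OF x] AB(1) by blast
    then have "poly F (of_real x) \<noteq> 0"
      using *(2) by (metis mult_zero_right poly_mult)
    moreover have "poly A (of_real x) = poly A' (of_real x) * poly F (of_real x)"
      "poly B (of_real x) = poly B' (of_real x) * poly F (of_real x)"
      by (simp_all add: *(1,2))
    ultimately show ?thesis
      using AB(2) x by simp
  qed
  ultimately show ?thesis
    using *(3) by (intro exI[of _ A'] exI[of _ B']) blast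
qed

lemma level_dev_suminf_cyclotomic:
  "\<exists>R. cyclotomic_fraction R \<and> (\<forall>x. 0 < x \<and> x < 1 \<longrightarrow> x ^ Suc r * (\<Sum>N. level_dev x (Suc r) N) = x * R x - G x)"
proof (induction r)
  case 0
  have "cyclotomic_fraction (\<lambda>x. inverse (1 - x ^ 1))"
    by (rule cyclotomic_fraction_inverse) simp
  moreover have "x ^ Suc 0 * (\<Sum>N. level_dev x (Suc 0) N) = x * inverse (1 - x ^ 1) - G x" if "0 < x" "x < 1" for x
    using suminf_level_dev_1[OF that] by (simp add: divide_inverse)
  ultimately show ?case by blast
next
  case (Suc r)
  then obtain R where R: "cyclotomic_fraction R"
    "\<And>x. 0 < x \<Longrightarrow> x < 1 \<Longrightarrow> x ^ Suc r * (\<Sum>N. level_dev x (Suc r) N) = x * R x - G x"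
    by blast
  \<comment> \<open>The addend is the boundary term of \<open>suminf_level_dev_rec\<close> divided
    by x, spelled with sums and products to match the closure lemmas.\<close>
  define R' where "R' = (\<lambda>x. R x + (- 1) * x ^ r *
     ((1 + (- 1) * x ^ 1) * inverse (1 - x ^ Suc (Suc r)) + (- 1) * inverse (1 - x ^ Suc r)) * inverse (1 - x ^ Suc r))"
  have "cyclotomic_fraction R'"
    unfolding R'_def
    by (intro cyclotomic_fraction_add cyclotomic_fraction_mult R(1) cyclotomic_fraction_const
        cyclotomic_fraction_power cyclotomic_fraction_inverse) auto
  moreover have "x ^ Suc (Suc r) * (\<Sum>N. level_dev x (Suc (Suc r)) N) = x * R' x - G x" if x: "0 < x" "x < 1" for x
  proof -
    define i j where "i = inverse (1 - x ^ Suc r)" and "j = inverse (1 - x ^ Suc (Suc r))"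
    have "level_dev x (Suc r) 0 = (1 - x) * j - i"
      by (simp only: level_dev_def level_trace_0[OF x] divide_inverse i_def j_def mult_1_left)
    then have "x ^ Suc (Suc r) * (\<Sum>N. level_dev x (Suc (Suc r)) N) =
        x * R x - G x - x ^ Suc r * ((1 - x) * j - i) * i"
      by (simp only: suminf_level_dev_rec[OF x] R(2)[OF x] divide_inverse i_def[symmetric])
    also have "\<dots> = x * R' x - G x"
      unfolding R'_def i_def[symmetric] j_def[symmetric] by (simp add: algebra_simps)
    finally show ?thesis .
  qed
  ultimately show ?case by blast
qed

theorem theorem6:
  fixes r :: nat
  assumes "r \<ge> 1"
  shows "\<exists>A B :: complex poly.
    coprime A B \<and> (\<forall>z. poly B z = 0 \<longrightarrow> (\<exists>k::nat. k \<ge> 1 \<and> z ^ k = 1)) \<and>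
    (\<forall>(q::real) (c::real). 0 < q \<and> q < 1 \<and> 0 < c \<longrightarrow>
       1 / 2 * psi0 c ((adj (beta q) \<circ> beta q) ^^ r) =
         of_real (q powi (- 2 * int r)) *
         (of_real (q\<^sup>2) * (poly A (of_real (q\<^sup>2)) / poly B (of_real (q\<^sup>2))) - of_real (G (q\<^sup>2))))"
proof -
  obtain r' where r: "r = Suc r'" using assms by (cases r) auto
  obtain R where R: "cyclotomic_fraction R"
    "\<And>x. 0 < x \<Longrightarrow> x < 1 \<Longrightarrow> x ^ r * (\<Sum>N. level_dev x r N) = x * R x - G x"
    using level_dev_suminf_cyclotomic[of r'] unfolding r by blast
  \<comment> \<open>The addend carries C_r / 2: its multiple by x^r has a factor x because r >= 1,
    which leaves the exponent r'.\<close>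
  define R' where "R' = (\<lambda>x. R x + x ^ r' * inverse (1 - x ^ r) * (1 / 2))"
  have "cyclotomic_fraction R'"
    unfolding R'_def using assms
    by (intro cyclotomic_fraction_add cyclotomic_fraction_mult R(1) cyclotomic_fraction_const
        cyclotomic_fraction_power cyclotomic_fraction_inverse)
  from cyclotomic_fraction_coprime[OF this] obtain A B :: "complex poly" where AB: "coprime A B"
    "\<forall>z. poly B z = 0 \<longrightarrow> (\<exists>k::nat. k \<ge> 1 \<and> z ^ k = 1)"
    "\<forall>x. 0 < x \<and> x < 1 \<longrightarrow> complex_of_real (R' x) = poly A (of_real x) / poly B (of_real x)"
    by blast
  have "1 / 2 * psi0 c ((adj (beta q) \<circ> beta q) ^^ r) =
         of_real (q powi (- 2 * int r)) *
         (of_real (q\<^sup>2) * (poly A (of_real (q\<^sup>2)) / poly B (of_real (q\<^sup>2))) - of_real (G (q\<^sup>2)))"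
    if q: "0 < q" "q < 1" and c: "0 < c" for q c :: real
  proof -
    define x where "x = q\<^sup>2"
    have x: "0 < x" "x < 1"
      using q by (auto simp: x_def power_less_one_iff)
    have "- 2 * int r = - int (2 * r)" by simp
    then have "q powi (- 2 * int r) = inverse (x ^ r)"
      by (simp only: power_int_minus power_int_of_nat power_mult x_def)
    then have "q powi (- 2 * int r) * x ^ r = 1"
      using x by simp
    then have "(\<Sum>N. level_dev x r N) + 1 / (1 - x ^ r) / 2 =
        q powi (- 2 * int r) * (x ^ r * (\<Sum>N. level_dev x r N) + x ^ r * (1 / (1 - x ^ r) / 2))"
      by (simp add: distrib_left mult.assoc[symmetric])
    also have "x ^ r * (1 / (1 - x ^ r) / 2) = x * (x ^ r' * inverse (1 - x ^ r) * (1 / 2))"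
      by (simp only: r power_Suc divide_inverse mult_1_left mult.assoc)
    also have "x ^ r * (\<Sum>N. level_dev x r N) + x * (x ^ r' * inverse (1 - x ^ r) * (1 / 2)) = x * R' x - G x"
      unfolding R(2)[OF x] R'_def by (simp add: distrib_left)
    finally have *: "(\<Sum>N. level_dev x r N) + 1 / (1 - x ^ r) / 2 = q powi (- 2 * int r) * (x * R' x - G x)" .
    have "1 / 2 * (2 * z) = z" for z :: complex by simp
    then have "1 / 2 * psi0 c ((adj (beta q) \<circ> beta q) ^^ r) = of_real ((\<Sum>N. level_dev x r N) + 1 / (1 - x ^ r) / 2)"
      unfolding r psi0_modulus[OF q c, of r'] x_def .
    also have "\<dots> = of_real (q powi (- 2 * int r)) * (of_real x * (poly A (of_real x) / poly B (of_real x)) - of_real (G x))"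
      using AB(3) x by (simp only: * of_real_mult of_real_diff simp_thms)
    finally show ?thesis unfolding x_def .
  qed
  then show ?thesis
    using AB(1,2) by (intro exI[of _ A] exI[of _ B]) blast
qed

end
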